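(* Let $G=(V,E)$ be a finite connected outerplanar graph with no universal vertex, and with a fixed outerplanar embedding $\Pi$. Then $\mathrm{cc}(G)=2$ if and only if $\Pi$ has at most one internal $k$-face with $k\in\{5,6\}$ and no internal $t$-face with $t>6$.
   Context: All graphs are finite, connected and reflexive (a loop at every vertex; moving along a loop means passing); loops are ignored in embeddings and faces. An internal face of an outerplanar embedding is a bounded face (all vertices lie on the unbounded face); a $k$-face is a face whose boundary has length $k$. A universal vertex is one adjacent to all other vertices. Cops and Attacking Robbers: the cop player places $k$ cops on vertices, then the robber chooses a vertex. In each round the cops move (each cop moves to an adjacent vertex or passes), then the robber moves (to an adjacent vertex or passes). The cops win if after finitely many moves a cop moves onto the robber's vertex. Additionally, if the robber moves onto a vertex occupied by a cop, exactly one cop on that vertex is removed from the game; the robber's initial placement on a cop's vertex does not count as an attack. Both players play optimally. The attacking cop number $\mathrm{cc}(G)$ is the least $k$ such that $k$ cops can guarantee a win. *)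

theory Defs
  imports Main "HOL-Library.Multiset"
begin

text \<open>A graph is a finite vertex set V with a symmetric, irreflexive adjacency E
  (loops are implicit: the game uses closed neighbourhoods, and loops are ignored
  in embeddings and faces).\<close>

definition graph :: "'a set \<Rightarrow> ('a \<Rightarrow> 'a \<Rightarrow> bool) \<Rightarrow> bool" where
  "graph V E \<longleftrightarrow> finite V \<and> (\<forall>u v. E u v \<longrightarrow> u \<in> V \<and> v \<in> V)
     \<and> (\<forall>u v. E u v \<longrightarrow> E v u) \<and> (\<forall>v. \<not> E v v)"

definition connected_graph :: "'a set \<Rightarrow> ('a \<Rightarrow> 'a \<Rightarrow> bool) \<Rightarrow> bool" where
  "connected_graph V E \<longleftrightarrow> V \<noteq> {} \<and> (\<forall>u\<in>V. \<forall>v\<in>V. E\<^sup>*\<^sup>* u v)"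

definition universal_vertex :: "'a set \<Rightarrow> ('a \<Rightarrow> 'a \<Rightarrow> bool) \<Rightarrow> 'a \<Rightarrow> bool" where
  "universal_vertex V E v \<longleftrightarrow> v \<in> V \<and> (\<forall>u\<in>V. u \<noteq> v \<longrightarrow> E v u)"

definition nbrs :: "('a \<Rightarrow> 'a \<Rightarrow> bool) \<Rightarrow> 'a \<Rightarrow> 'a set" where
  "nbrs E v = {u. E v u}"

definition darts :: "'a set \<Rightarrow> ('a \<Rightarrow> 'a \<Rightarrow> bool) \<Rightarrow> ('a \<times> 'a) set" where
  "darts V E = {(u, v). u \<in> V \<and> v \<in> V \<and> E u v}"

text \<open>A rotation system: at every vertex v, sigma v is a cyclic permutation of
  the neighbours of v (the clockwise order of the edges around v).\<close>

definition rotation_system ::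
  "'a set \<Rightarrow> ('a \<Rightarrow> 'a \<Rightarrow> bool) \<Rightarrow> ('a \<Rightarrow> 'a \<Rightarrow> 'a) \<Rightarrow> bool" where
  "rotation_system V E \<sigma> \<longleftrightarrow>
     (\<forall>v\<in>V. bij_betw (\<sigma> v) (nbrs E v) (nbrs E v)
        \<and> (\<forall>u\<in>nbrs E v. \<forall>w\<in>nbrs E v. \<exists>n. (\<sigma> v ^^ n) u = w))"

definition face_step :: "('a \<Rightarrow> 'a \<Rightarrow> 'a) \<Rightarrow> 'a \<times> 'a \<Rightarrow> 'a \<times> 'a" where
  "face_step \<sigma> d = (snd d, \<sigma> (snd d) (fst d))"

definition face_of :: "('a \<Rightarrow> 'a \<Rightarrow> 'a) \<Rightarrow> 'a \<times> 'a \<Rightarrow> ('a \<times> 'a) set" where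
  "face_of \<sigma> d = {(face_step \<sigma> ^^ n) d | n. True}"

text \<open>Faces are the orbits of the face-tracing permutation on darts; the length
  of (the boundary walk of) a face is the number of darts in its orbit.\<close>

definition faces ::
  "'a set \<Rightarrow> ('a \<Rightarrow> 'a \<Rightarrow> bool) \<Rightarrow> ('a \<Rightarrow> 'a \<Rightarrow> 'a) \<Rightarrow> ('a \<times> 'a) set set" where
  "faces V E \<sigma> = face_of \<sigma> ` darts V E"

text \<open>Plane embedding: Euler's formula |V| - |E| + |F| = 2 (genus 0).\<close>

definition plane_embedding ::
  "'a set \<Rightarrow> ('a \<Rightarrow> 'a \<Rightarrow> bool) \<Rightarrow> ('a \<Rightarrow> 'a \<Rightarrow> 'a) \<Rightarrow> bool" where
  "plane_embedding V E \<sigma> \<longleftrightarrow> rotation_system V E \<sigma> \<and>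
     card V + card (faces V E \<sigma>) = card (darts V E) div 2 + 2"

text \<open>An outerplanar embedding: a plane embedding together with a designated
  unbounded (outer) face Of on whose boundary every vertex lies.\<close>

definition outerplanar_embedding ::
  "'a set \<Rightarrow> ('a \<Rightarrow> 'a \<Rightarrow> bool) \<Rightarrow> ('a \<Rightarrow> 'a \<Rightarrow> 'a) \<Rightarrow> ('a \<times> 'a) set \<Rightarrow> bool" where
  "outerplanar_embedding V E \<sigma> Of \<longleftrightarrow> plane_embedding V E \<sigma> \<and>
     Of \<in> faces V E \<sigma> \<and> (\<forall>v\<in>V. \<exists>w. (v, w) \<in> Of)"

definition internal_faces ::
  "'a set \<Rightarrow> ('a \<Rightarrow> 'a \<Rightarrow> bool) \<Rightarrow> ('a \<Rightarrow> 'a \<Rightarrow> 'a) \<Rightarrow> ('a \<times> 'a) set \<Rightarrow> ('a \<times> 'a) set set" where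
  "internal_faces V E \<sigma> Of = faces V E \<sigma> - {Of}"

definition cmove :: "('a \<Rightarrow> 'a \<Rightarrow> bool) \<Rightarrow> 'a \<Rightarrow> 'a \<Rightarrow> bool" where
  "cmove E x y \<longleftrightarrow> x = y \<or> E x y"

text \<open>cop_win E C r: it is the cops' turn, the (remaining) cops stand on the
  multiset of vertices C, the robber is on r, and the cops can force a capture
  in finitely many moves (least fixed point = reachability). After the cops'
  move C', if a cop is on r the cops win; otherwise the robber moves to r', and
  if r' carries a cop exactly one cop there is removed.\<close>

inductive cop_win :: "('a \<Rightarrow> 'a \<Rightarrow> bool) \<Rightarrow> 'a multiset \<Rightarrow> 'a \<Rightarrow> bool"
  for E where
  capture: "rel_mset (cmove E) C C' \<Longrightarrow> r \<in># C' \<Longrightarrow> cop_win E C r"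
| step: "rel_mset (cmove E) C C' \<Longrightarrow> r \<notin># C' \<Longrightarrow>
    (\<forall>r'. cmove E r r' \<longrightarrow>
        cop_win E (if r' \<in># C' then C' - {#r'#} else C') r') \<Longrightarrow> cop_win E C r"

definition cops_win :: "'a set \<Rightarrow> ('a \<Rightarrow> 'a \<Rightarrow> bool) \<Rightarrow> nat \<Rightarrow> bool" where
  "cops_win V E k \<longleftrightarrow>
     (\<exists>C. size C = k \<and> set_mset C \<subseteq> V \<and> (\<forall>r\<in>V. cop_win E C r))"

definition attacking_cop_number :: "'a set \<Rightarrow> ('a \<Rightarrow> 'a \<Rightarrow> bool) \<Rightarrow> nat" where
  "attacking_cop_number V E = (LEAST k. cops_win V E k)"

end

theory Submission
  imports Defs "HOL-Number_Theory.Cong" "HOL-Combinatorics.Orbits"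
begin

text \<open>
  Counting mod 2, Euler's formula says that every edge set with all degrees even is the boundary of a
  unique set of internal faces: a discrete Jordan curve theorem. As every vertex lies on the outer face,
  an even edge set encloses no face at a vertex it does not touch. Hence the inside of an induced cycle
  is a single face, and every internal face arises in this way; moreover a component of the graph minus
  an induced cycle attaches to at most two vertices of the cycle, which are adjacent.

  Robber: on an induced cycle of length at least 5, a robber who is not captured immediately can always
  pass, attack safely, or step to a safe neighbour on the cycle. So two cops win only if they dominate
  all such cycles at the start; they cannot dominate a cycle of length at least 7, nor two different
  cycles of length at least 5.

  Cops: they stay on equal or adjacent vertices \<open>u\<close>, \<open>v\<close>, so that they protect each other, and shrink
  the component of the robber in the graph minus \<open>u\<close>, \<open>v\<close>. If it attaches to both, the edge \<open>uv\<close> lies on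
  an induced cycle through the component, which has length at most 4, and the cops can move to the edge
  of that cycle behind which the robber sits. If there is a cycle of length 5 or 6, they start by
  dominating it and then close in on the edge at which the component of the robber attaches.
\<close>

notation sym_diff (infixl "\<triangle>" 65)

section \<open>Edge sets modulo 2\<close>

lemma sym_diff_iff: "x \<in> A \<triangle> B \<longleftrightarrow> (x \<in> A \<longleftrightarrow> x \<notin> B)"
  by blast

lemma even_card_sym_diff_iff:
  assumes "finite A" "finite B"
  shows "even (card (A \<triangle> B)) \<longleftrightarrow> (even (card A) \<longleftrightarrow> even (card B))"
proof -
  have "card A = card (A - B) + card (A \<inter> B)" "card B = card (B - A) + card (A \<inter> B)"
    using assms card_Int_Diff[of A B] card_Int_Diff[of B A] by (simp_all add: Int_commute)
  moreover have "card (A \<triangle> B) = card (A - B) + card (B - A)"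
    using assms by (intro card_Un_disjoint) auto
  ultimately show ?thesis by simp presburger
qed

lemma even_card_disagreements_permutation:
  assumes "finite N" and bij: "bij_betw p N N"
  shows "even (card {w\<in>N. g w \<longleftrightarrow> \<not> g (p w)})"
proof -
  let ?A = "{w\<in>N. g w}" and ?B = "{w\<in>N. g (p w)}"
  have "p ` ?B = ?A" "inj_on p ?B"
    using bij unfolding bij_betw_def inj_on_def by auto
  then have "card ?A = card ?B"
    using card_image by fastforce
  moreover have "{w\<in>N. g w \<longleftrightarrow> \<not> g (p w)} = ?A \<triangle> ?B" by auto
  ultimately show ?thesis
    using even_card_sym_diff_iff[of ?A ?B] assms(1) by simp
qed

definition edges_of :: "('a \<Rightarrow> 'a \<Rightarrow> bool) \<Rightarrow> 'a set set" where
  "edges_of R = {{u, v} |u v. R u v}"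

definition odd_vertices :: "'a set set \<Rightarrow> 'a set" where
  "odd_vertices Z = {v. odd (card {w. {v, w} \<in> Z})}"

lemma edges_of_iff: "symp R \<Longrightarrow> {u, v} \<in> edges_of R \<longleftrightarrow> R u v"
  unfolding edges_of_def by (auto simp: doubleton_eq_iff dest: sympD)

lemma finite_incident:
  assumes "finite Z"
  shows "finite {w. {v, w} \<in> Z}"
proof -
  have "inj (\<lambda>w. {v, w})" by (auto simp: inj_def doubleton_eq_iff)
  then show ?thesis
    using finite_vimageI[OF assms] unfolding vimage_def by blast
qed

lemma odd_vertices_empty [simp]: "odd_vertices {} = {}"
  unfolding odd_vertices_def by simp

lemma odd_vertices_edge: "x \<noteq> y \<Longrightarrow> odd_vertices {{x, y}} = {x, y}"
proof -
  assume "x \<noteq> y"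
  then have "{w. {v, w} = {x, y}} = (if v = x then {y} else if v = y then {x} else {})" for v
    by (auto simp: doubleton_eq_iff)
  then show ?thesis unfolding odd_vertices_def by auto
qed

lemma odd_vertices_sym_diff:
  assumes "finite Y" "finite Z"
  shows "odd_vertices (Y \<triangle> Z) = odd_vertices Y \<triangle> odd_vertices Z"
proof -
  have "{w. {v, w} \<in> Y \<triangle> Z} = {w. {v, w} \<in> Y} \<triangle> {w. {v, w} \<in> Z}" for v
    by auto
  then have "even (card {w. {v, w} \<in> Y \<triangle> Z}) \<longleftrightarrow>
      (even (card {w. {v, w} \<in> Y}) \<longleftrightarrow> even (card {w. {v, w} \<in> Z}))" for v
    using even_card_sym_diff_iff[OF finite_incident[OF assms(1)] finite_incident[OF assms(2)]] by presburger
  then show ?thesis unfolding odd_vertices_def by blast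
qed

text \<open>\<open>walk R x n Z y\<close>: an \<open>R\<close>-walk of length \<open>n\<close> from \<open>x\<close> to \<open>y\<close>
  uses exactly the edges in \<open>Z\<close> an odd number of times.\<close>

inductive walk :: "('a \<Rightarrow> 'a \<Rightarrow> bool) \<Rightarrow> 'a \<Rightarrow> nat \<Rightarrow> 'a set set \<Rightarrow> 'a \<Rightarrow> bool" for R x where
  walk_0: "walk R x 0 {} x"
| walk_Suc: "walk R x n Z y \<Longrightarrow> R y z \<Longrightarrow> walk R x (Suc n) (Z \<triangle> {{y, z}}) z"

lemma walk_edge: "R x y \<Longrightarrow> walk R x (Suc 0) {{x, y}} y"
  using walk_Suc[OF walk_0, of R x y] by simp

lemma walk_append:
  assumes "walk R x m Y y" "walk R y n Z z"
  shows "walk R x (m + n) (Y \<triangle> Z) z"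
  using assms(2)
proof induction
  case walk_0
  then show ?case using assms(1) by simp
next
  case (walk_Suc n Z z z')
  then have "walk R x (Suc (m + n)) (Y \<triangle> Z \<triangle> {{z, z'}}) z'"
    by (intro walk.walk_Suc)
  moreover have "Y \<triangle> Z \<triangle> {{z, z'}} = Y \<triangle> (Z \<triangle> {{z, z'}})" by blast
  ultimately show ?case by (simp only: add_Suc_right)
qed

lemma walk_mono: "walk R x n Z y \<Longrightarrow> R \<le> S \<Longrightarrow> walk S x n Z y"
  by (induction rule: walk.induct) (auto intro: walk.intros)

lemma walk_of_rtranclp: "R\<^sup>*\<^sup>* x y \<Longrightarrow> \<exists>n Z. walk R x n Z y"
  by (induction rule: rtranclp_induct) (blast intro: walk.intros)+

lemma walk_finite: "walk R x n Z y \<Longrightarrow> finite Z"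
  by (induction rule: walk.induct) auto

lemma walk_subset_edges: "walk R x n Z y \<Longrightarrow> Z \<subseteq> edges_of R"
  by (induction rule: walk.induct) (auto simp: edges_of_def)

lemma odd_vertices_walk:
  assumes "walk R x n Z y" "irreflp R"
  shows "odd_vertices Z = {x} \<triangle> {y}"
  using assms(1)
proof induction
  case (walk_Suc n Z y z)
  then have "y \<noteq> z" using assms(2) by (auto dest: irreflpD)
  then show ?case
    using odd_vertices_sym_diff[OF walk_finite[OF walk_Suc.hyps(1)], of "{{y, z}}"]
      odd_vertices_edge[of y z] walk_Suc.IH
    by auto
qed simp

lemma closed_walk_short:
  assumes "walk R x n Z x" "n < 3" "irreflp R"
  shows "Z = {}"
proof -
  consider "n = 0" | "n = Suc 0" | "n = Suc (Suc 0)" using assms(2) by linarith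
  then show ?thesis
    using assms(1,3) by cases (auto elim!: walk.cases simp: insert_commute irreflp_def)
qed

lemma walk_prefixes:
  assumes "walk R x n Z y"
  shows "\<exists>p S. p 0 = x \<and> p n = y \<and> S 0 = {} \<and> S n = Z \<and>
    (\<forall>i<n. R (p i) (p (Suc i)) \<and> S (Suc i) = S i \<triangle> {{p i, p (Suc i)}})"
  using assms
proof induction
  case walk_0
  then show ?case by (intro exI[of _ "\<lambda>_. x"] exI[of _ "\<lambda>_. {}"]) simp
next
  case (walk_Suc n Z y z)
  then obtain p S where "p 0 = x" "p n = y" "S 0 = {}" "S n = Z"
    "\<forall>i<n. R (p i) (p (Suc i)) \<and> S (Suc i) = S i \<triangle> {{p i, p (Suc i)}}" by blast
  then show ?case
    using walk_Suc.hyps(2)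
    by (intro exI[of _ "p(Suc n := z)"] exI[of _ "S(Suc n := Z \<triangle> {{y, z}})"]) (simp add: less_Suc_eq)
qed

lemma walk_segment:
  assumes "\<And>k. k < n \<Longrightarrow> R (p k) (p (Suc k)) \<and> S (Suc k) = S k \<triangle> {{p k, p (Suc k)}}"
  shows "i + m \<le> n \<Longrightarrow> walk R (p i) m (S i \<triangle> S (i + m)) (p (i + m))"
proof (induction m)
  case 0
  then show ?case by (simp add: walk_0)
next
  case (Suc m)
  then have "walk R (p i) (Suc m) (S i \<triangle> S (i + m) \<triangle> {{p (i + m), p (Suc (i + m))}}) (p (Suc (i + m)))"
    using assms[of "i + m"] by (intro walk.walk_Suc) auto
  moreover have "S i \<triangle> S (i + m) \<triangle> {{p (i + m), p (Suc (i + m))}} = S i \<triangle> S (Suc (i + m))"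
    using assms[of "i + m"] Suc.prems by auto
  ultimately show ?case by simp
qed

definition boundary :: "('a \<times> 'a) set \<Rightarrow> 'a set set" where
  "boundary X = {{u, v} |u v. (u, v) \<in> X \<and> (v, u) \<notin> X}"

lemma boundary_iff: "{u, v} \<in> boundary X \<longleftrightarrow> ((u, v) \<in> X \<longleftrightarrow> (v, u) \<notin> X)"
  unfolding boundary_def by (auto simp: doubleton_eq_iff)

lemma boundary_empty [simp]: "boundary {} = {}"
  unfolding boundary_def by simp

lemma boundary_sym_diff:
  fixes X Y :: "('a \<times> 'a) set"
  shows "boundary (X \<triangle> Y) = boundary X \<triangle> boundary Y"
proof -
  have "e \<in> boundary (X \<triangle> Y) \<longleftrightarrow> e \<in> boundary X \<triangle> boundary Y" if "e = {u, v}" for e u v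
    unfolding that Un_iff Diff_iff boundary_iff by blast
  moreover have "\<exists>u v. e = {u, v}" if "e \<in> boundary W" for e and W :: "('a \<times> 'a) set"
    using that unfolding boundary_def by blast
  ultimately show ?thesis by (intro set_eqI) (metis DiffE UnE)
qed

lemma boundary_insert:
  assumes "u \<noteq> v" "(u, v) \<notin> X"
  shows "boundary (insert (u, v) X) = boundary X \<triangle> {{u, v}}"
proof -
  have "insert (u, v) X = X \<triangle> {(u, v)}" using assms(2) by auto
  moreover have "boundary {(u, v)} = {{u, v}}" using assms(1) unfolding boundary_def by auto
  ultimately show ?thesis by (simp only: boundary_sym_diff)
qed

section \<open>Induced cycles\<close>

locale simple_graph =
  fixes V :: "'a set" and E :: "'a \<Rightarrow> 'a \<Rightarrow> bool"
  assumes graph: "graph V E"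
begin

abbreviation edges :: "'a set set" where
  "edges \<equiv> edges_of E"

definition adj_in :: "'a set \<Rightarrow> 'a \<Rightarrow> 'a \<Rightarrow> bool" where
  "adj_in W u v \<longleftrightarrow> E u v \<and> u \<in> W \<and> v \<in> W"

abbreviation edges_in :: "'a set \<Rightarrow> 'a set set" where
  "edges_in W \<equiv> edges_of (adj_in W)"

definition even_edge_set :: "'a set set \<Rightarrow> bool" where
  "even_edge_set Z \<longleftrightarrow> Z \<subseteq> edges \<and> odd_vertices Z = {}"

lemma finite_vertices: "finite V"
  and adj_sym: "E u v \<Longrightarrow> E v u"
  and adj_irrefl: "\<not> E v v"
  and adj_vertices: "E u v \<Longrightarrow> u \<in> V" "E u v \<Longrightarrow> v \<in> V"
  using graph unfolding graph_def by blast+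

lemma symp_adj: "symp E"
  by (blast intro: sympI adj_sym)

lemma finite_neighbours: "finite {w. E v w}"
  by (rule finite_subset[OF _ finite_vertices]) (auto dest: adj_vertices)

lemma edges_iff [simp]: "{u, v} \<in> edges \<longleftrightarrow> E u v"
  by (rule edges_of_iff[OF symp_adj])

lemma edges_in_iff [simp]: "{u, v} \<in> edges_in W \<longleftrightarrow> E u v \<and> u \<in> W \<and> v \<in> W"
  using edges_of_iff[of "adj_in W" u v] adj_sym unfolding adj_in_def symp_def by blast

lemma edges_in_subset_edges: "edges_in W \<subseteq> edges"
  unfolding edges_of_def adj_in_def by blast

lemma finite_edges: "finite edges"
  by (rule finite_subset[of _ "Pow V"])
    (auto simp: edges_of_def finite_vertices dest: adj_vertices)

lemma finite_edges_in: "finite (edges_in W)"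
  by (rule finite_subset[OF edges_in_subset_edges finite_edges])

lemma irreflp_adj_in: "irreflp (adj_in W)"
  by (auto simp: irreflp_def adj_in_def adj_irrefl)

lemma adj_in_UNIV: "adj_in UNIV = E"
  by (simp add: adj_in_def fun_eq_iff)

lemma even_edge_set_sym_diff:
  assumes "even_edge_set Y" "even_edge_set Z"
  shows "even_edge_set (Y \<triangle> Z)"
  using assms odd_vertices_sym_diff[of Y Z] finite_subset[OF _ finite_edges]
  unfolding even_edge_set_def by auto

lemma path_edge_set:
  assumes "(adj_in W)\<^sup>*\<^sup>* x y"
  shows "\<exists>Z. Z \<subseteq> edges_in W \<and> odd_vertices Z = {x} \<triangle> {y}"
  using walk_of_rtranclp[OF assms] walk_subset_edges odd_vertices_walk irreflp_adj_in by metis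

lemma closed_walk_even:
  assumes "walk (adj_in W) x n Z x"
  shows "even_edge_set Z"
  using walk_subset_edges[OF assms] edges_in_subset_edges odd_vertices_walk[OF assms irreflp_adj_in]
  unfolding even_edge_set_def by blast

definition cycle_enum :: "(int \<Rightarrow> 'a) \<Rightarrow> nat \<Rightarrow> bool" where
  "cycle_enum c n \<longleftrightarrow> 3 \<le> n \<and> (\<forall>i j. c i = c j \<longleftrightarrow> [i = j] (mod int n)) \<and>
    (\<forall>i j. E (c i) (c j) \<longleftrightarrow> [j = i + 1] (mod int n) \<or> [i = j + 1] (mod int n))"

definition induced_cycle :: "'a set \<Rightarrow> bool" where
  "induced_cycle C \<longleftrightarrow> (\<exists>c n. cycle_enum c n \<and> range c = C)"

lemma cycle_enum_shift:
  assumes "cycle_enum c n"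
  shows "cycle_enum (\<lambda>i. c (i + k)) n"
proof -
  have "[j + k = i + k + 1] (mod int n) \<longleftrightarrow> [j = i + 1] (mod int n)" for i j
    using cong_add_rcancel[of j k "i + 1"] by (simp add: algebra_simps)
  then show ?thesis
    using assms unfolding cycle_enum_def by (simp add: cong_add_rcancel)
qed

lemma bij_betw_cycle_enum:
  assumes "cycle_enum c n"
  shows "bij_betw c {0..<int n} (range c)"
proof (rule bij_betw_imageI)
  show "inj_on c {0..<int n}"
    using assms cong_less_imp_eq_int unfolding cycle_enum_def inj_on_def by auto
  have "c i = c (i mod int n)" "i mod int n \<in> {0..<int n}" for i
    using assms unfolding cycle_enum_def by (auto simp: cong_def)
  then show "c ` {0..<int n} = range c" by blast
qed

lemma card_cycle_enum: "cycle_enum c n \<Longrightarrow> card (range c) = n"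
  using bij_betw_same_card[OF bij_betw_cycle_enum] by simp

lemma cycle_enum_index:
  assumes "cycle_enum c n" "v \<in> range c"
  obtains i where "0 \<le> i" "i < int n" "c i = v"
proof -
  have "v \<in> c ` {0..<int n}"
    using bij_betw_imp_surj_on[OF bij_betw_cycle_enum[OF assms(1)]] assms(2) by simp
  then show ?thesis using that by auto
qed

lemma induced_cycle_enum:
  assumes "induced_cycle C"
  obtains c where "cycle_enum c (card C)" "range c = C"
  using assms card_cycle_enum unfolding induced_cycle_def by blast

lemma induced_cycle_enum_from:
  assumes "induced_cycle C" "a \<in> C"
  obtains c where "cycle_enum c (card C)" "range c = C" "c 0 = a"
proof -
  obtain c where enum: "cycle_enum c (card C)" "range c = C" using induced_cycle_enum[OF assms(1)] .
  moreover obtain k where "c k = a" using assms(2) enum(2) by blast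
  moreover have "range (\<lambda>i. c (i + k)) = range c"
    using surj_plus_right[of k] by (metis image_image)
  ultimately show ?thesis
    using that[of "\<lambda>i. c (i + k)"] cycle_enum_shift by auto
qed

lemma induced_cycle_card_ge: "induced_cycle C \<Longrightarrow> 3 \<le> card C"
  unfolding induced_cycle_def using card_cycle_enum cycle_enum_def by auto

lemma induced_cycle_finite: "induced_cycle C \<Longrightarrow> finite C"
  using induced_cycle_card_ge card.infinite by fastforce

lemma induced_cycle_nonempty: "induced_cycle C \<Longrightarrow> C \<noteq> {}"
  unfolding induced_cycle_def by auto

lemma cycle_enum_adj: "cycle_enum c n \<Longrightarrow> E (c i) (c (i + 1))"
  unfolding cycle_enum_def by simp

lemma cycle_enum_neighbours:
  assumes "cycle_enum c n"
  shows "{w\<in>range c. E (c i) w} = {c (i - 1), c (i + 1)}" "c (i - 1) \<noteq> c (i + 1)"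
proof -
  have "[i = j + 1] (mod int n) \<longleftrightarrow> [j = i - 1] (mod int n)" for j
    by (auto simp: cong_iff_dvd_diff dvd_diff_commute algebra_simps)
  then show "{w\<in>range c. E (c i) w} = {c (i - 1), c (i + 1)}"
    using assms unfolding cycle_enum_def by auto
  have "\<not> int n dvd 2" using assms zdvd_not_zless[of 2 "int n"] unfolding cycle_enum_def by simp
  then show "c (i - 1) \<noteq> c (i + 1)"
    using assms unfolding cycle_enum_def by (simp add: cong_iff_dvd_diff)
qed

lemma induced_cycle_neighbours:
  assumes "induced_cycle C" "v \<in> C"
  obtains p q where "p \<noteq> q" "{w\<in>C. E v w} = {p, q}"
proof -
  obtain c where enum: "cycle_enum c (card C)" "range c = C" "c 0 = v"
    using induced_cycle_enum_from[OF assms] .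
  show ?thesis using that cycle_enum_neighbours[OF enum(1), of 0] enum(2,3) by simp
qed

lemma card_induced_cycle_neighbours: "induced_cycle C \<Longrightarrow> v \<in> C \<Longrightarrow> card {w\<in>C. E v w} = 2"
  using induced_cycle_neighbours[of C v] by (metis card_2_iff)

lemma induced_cycle_subset_vertices:
  assumes "induced_cycle C"
  shows "C \<subseteq> V"
proof
  fix v assume "v \<in> C"
  then obtain p q where "{w\<in>C. E v w} = {p, q}" using induced_cycle_neighbours assms by metis
  then show "v \<in> V" using adj_vertices(1) by blast
qed

lemma cycle_enum_segment_connected:
  assumes enum: "cycle_enum c n" and "i \<le> j" and within: "\<And>k. i \<le> k \<Longrightarrow> k \<le> j \<Longrightarrow> c k \<in> W"
  shows "(adj_in W)\<^sup>*\<^sup>* (c i) (c j)"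
proof -
  have "i \<le> k \<Longrightarrow> k \<le> j \<Longrightarrow> (adj_in W)\<^sup>*\<^sup>* (c i) (c k)" for k
  proof (induction k rule: int_ge_induct)
    case (step k)
    then have "adj_in W (c k) (c (k + 1))"
      using within[of k] within[of "k + 1"] cycle_enum_adj[OF enum] unfolding adj_in_def by simp
    then show ?case using step by (simp add: rtranclp.rtrancl_into_rtrancl)
  qed simp
  then show ?thesis using \<open>i \<le> j\<close> by simp
qed

lemma induced_cycle_connected:
  assumes "induced_cycle C" "u \<in> C" "v \<in> C"
  shows "(adj_in C)\<^sup>*\<^sup>* u v"
proof -
  obtain c where enum: "cycle_enum c (card C)" "range c = C" "c 0 = u"
    using induced_cycle_enum_from[OF assms(1,2)] .
  moreover obtain i where "0 \<le> i" "c i = v"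
    using cycle_enum_index[OF enum(1)] assms(3) enum(2) by metis
  ultimately show ?thesis
    using cycle_enum_segment_connected[OF enum(1), of 0 i C] by blast
qed

lemma induced_cycle_closed_subset:
  assumes "induced_cycle C" "u \<in> S" "S \<subseteq> C" "\<And>x y. x \<in> S \<Longrightarrow> y \<in> C \<Longrightarrow> E x y \<Longrightarrow> y \<in> S"
  shows "S = C"
proof
  show "C \<subseteq> S"
  proof
    fix v assume "v \<in> C"
    then have "(adj_in C)\<^sup>*\<^sup>* u v" using induced_cycle_connected assms(1-3) by blast
    then show "v \<in> S"
      by (induction rule: rtranclp_induct) (use assms in \<open>auto simp: adj_in_def\<close>)
  qed
qed (rule assms(3))

lemma induced_cycle_subset_eq:
  assumes "induced_cycle C" "induced_cycle C'" "C \<subseteq> C'"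
  shows "C = C'"
proof -
  obtain u where "u \<in> C" using induced_cycle_nonempty[OF assms(1)] by blast
  moreover have "{w\<in>C. E v w} = {w\<in>C'. E v w}" if "v \<in> C" for v
    by (rule card_subset_eq)
      (use that assms induced_cycle_finite[OF assms(2)] in
        \<open>auto simp: card_induced_cycle_neighbours subset_iff\<close>)
  ultimately show ?thesis
    by (intro induced_cycle_closed_subset[OF assms(2) _ assms(3)]) blast+
qed

lemma induced_cycle_neighbours_eq:
  assumes cycle: "induced_cycle C" and "v \<in> C" "p \<in> C" "q \<in> C" "E v p" "E v q" "p \<noteq> q"
  shows "{w\<in>C. E v w} = {p, q}"
  by (rule card_subset_eq[symmetric])
    (use assms induced_cycle_finite[OF cycle] in \<open>auto simp: card_induced_cycle_neighbours[OF cycle]\<close>)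

lemma induced_cycle_other_neighbour:
  assumes "induced_cycle C" "v \<in> C" "p \<in> C" "E v p"
  obtains q where "{w\<in>C. E v w} = {p, q}" "q \<noteq> p"
proof -
  obtain x y where xy: "x \<noteq> y" "{w\<in>C. E v w} = {x, y}"
    using induced_cycle_neighbours[OF assms(1,2)] .
  then consider "p = x" | "p = y" using assms(3,4) by blast
  then show ?thesis using that[of y] that[of x] xy by cases auto
qed

lemma induced_cycle_triangle:
  assumes cycle: "induced_cycle C" and abc: "a \<in> C" "b \<in> C" "c \<in> C" and adj: "E a b" "E b c" "E a c"
  shows "C = {a, b, c}"
proof -
  have "a \<noteq> b" "b \<noteq> c" "a \<noteq> c" using adj adj_irrefl by blast+
  then have "{w\<in>C. E a w} = {b, c}" "{w\<in>C. E b w} = {a, c}" "{w\<in>C. E c w} = {a, b}"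
    using abc adj adj[THEN adj_sym] by (simp_all add: induced_cycle_neighbours_eq[OF cycle])
  then show ?thesis
    using abc by (intro induced_cycle_closed_subset[OF cycle, of a, symmetric]) auto
qed

lemma edges_in_even:
  assumes "induced_cycle C"
  shows "even_edge_set (edges_in C)"
proof -
  have "{w. {v, w} \<in> edges_in C} = (if v \<in> C then {w\<in>C. E v w} else {})" for v
    by auto
  then show ?thesis
    using assms edges_in_subset_edges card_induced_cycle_neighbours
    unfolding even_edge_set_def odd_vertices_def by simp
qed

lemma Union_edges_in:
  assumes "induced_cycle C"
  shows "\<Union>(edges_in C) = C"
proof
  show "C \<subseteq> \<Union>(edges_in C)"
  proof
    fix v assume v_in: "v \<in> C"
    then obtain p q where "{w\<in>C. E v w} = {p, q}" using induced_cycle_neighbours assms by metis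
    then have "{v, p} \<in> edges_in C" using v_in by auto
    then show "v \<in> \<Union>(edges_in C)" by blast
  qed
qed (auto simp: edges_of_def adj_in_def)

lemma card_edges_in:
  assumes "induced_cycle C"
  shows "card (edges_in C) = card C"
proof -
  obtain c where enum: "cycle_enum c (card C)" "range c = C" using induced_cycle_enum[OF assms] .
  let ?e = "\<lambda>i. {c i, c (i + 1)}" and ?I = "{0..<int (card C)}"
  have eq: "c i = c j \<longleftrightarrow> [i = j] (mod int (card C))" for i j
    using enum(1) unfolding cycle_enum_def by blast
  have "inj_on ?e ?I"
  proof (rule inj_onI)
    fix i j assume ij: "i \<in> ?I" "j \<in> ?I" "?e i = ?e j"
    have "c (i + 1) \<noteq> c j" if "c i = c (j + 1)"
    proof -
      have "c (i + 1) = c (j + 1 + 1)" using that cong_add_rcancel[of i 1 "j + 1"] unfolding eq by simp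
      then show ?thesis using cycle_enum_neighbours(2)[OF enum(1), of "j + 1"] by simp
    qed
    then have "c i = c j" using ij(3) by (auto simp: doubleton_eq_iff)
    then show "i = j"
      using ij(1,2) bij_betw_imp_inj_on[OF bij_betw_cycle_enum[OF enum(1)]] by (auto dest: inj_onD)
  qed
  moreover have "?e ` ?I = edges_in C"
  proof
    show "edges_in C \<subseteq> ?e ` ?I"
    proof
      fix f assume "f \<in> edges_in C"
      then obtain i j where f: "f = {c i, c j}" "E (c i) (c j)"
        using enum(2) unfolding edges_of_def adj_in_def by blast
      then have "c j = c (i + 1) \<or> c i = c (j + 1)"
        using enum(1) unfolding cycle_enum_def by blast
      then obtain k where "f = {c k, c (k + 1)}" using f(1) by (auto simp: insert_commute)
      also have "c k = c (k mod int (card C))"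
        unfolding eq by (simp add: cong_def)
      also have "c (k + 1) = c (k mod int (card C) + 1)"
        unfolding eq by (simp add: cong_def mod_add_left_eq)
      finally show "f \<in> ?e ` ?I"
        using induced_cycle_card_ge[OF assms] by (intro image_eqI) auto
    qed
  qed (use cycle_enum_adj[OF enum(1)] enum(2) in auto)
  ultimately show ?thesis using card_image by fastforce
qed

lemma edges_in_triangle:
  assumes cycle: "induced_cycle C" and abc: "a \<in> C" "b \<in> C" "c \<in> C" and adj: "E a b" "E b c" "E a c"
  shows "edges_in C = {{a, b}, {b, c}, {a, c}}"
proof (rule card_subset_eq[OF finite_edges_in, symmetric])
  have "a \<noteq> b" "b \<noteq> c" "a \<noteq> c" using adj adj_irrefl by blast+
  then show "card {{a, b}, {b, c}, {a, c}} = card (edges_in C)"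
    unfolding card_edges_in[OF cycle] unfolding induced_cycle_triangle[OF cycle abc adj]
    by (simp add: doubleton_eq_iff)
qed (use abc adj in simp)

lemma even_at_cycle_vertex:
  assumes cycle: "induced_cycle C" and Z: "Z \<subseteq> edges_in C" "v \<notin> odd_vertices Z"
    and incident: "{v, w} \<in> Z" "{v, w'} \<in> edges_in C"
  shows "{v, w'} \<in> Z"
proof -
  have sub: "{x. {v, x} \<in> Z} \<subseteq> {x\<in>C. E v x}" using Z(1) by auto
  have fin: "finite {x\<in>C. E v x}" using induced_cycle_finite[OF cycle] by simp
  have "v \<in> C" using incident(2) by simp
  then have "card {x\<in>C. E v x} = 2" by (rule card_induced_cycle_neighbours[OF cycle])
  moreover have "even (card {x. {v, x} \<in> Z})" using Z(2) unfolding odd_vertices_def by simp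
  moreover have "card {x. {v, x} \<in> Z} \<noteq> 0"
    using incident(1) finite_subset[OF sub fin] by auto
  ultimately have "card {x\<in>C. E v x} \<le> card {x. {v, x} \<in> Z}"
    by (metis dvd_imp_le not_gr_zero)
  then have "{x. {v, x} \<in> Z} = {x\<in>C. E v x}" by (rule card_seteq[OF fin sub])
  then show ?thesis using incident(2) by auto
qed

lemma even_subset_edges_in:
  assumes cycle: "induced_cycle C" and Z: "even_edge_set Z" "Z \<subseteq> edges_in C" "Z \<noteq> {}"
  shows "Z = edges_in C"
proof -
  have all: "{v, w'} \<in> Z" if "{v, w} \<in> Z" "{v, w'} \<in> edges_in C" for v w w'
    using even_at_cycle_vertex[OF cycle Z(2) _ that] Z(1) unfolding even_edge_set_def by blast
  obtain u w where uw: "{u, w} \<in> Z"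
    using Z(2,3) unfolding edges_of_def by blast
  have "{v\<in>C. \<exists>w. {v, w} \<in> Z} = C"
  proof (rule induced_cycle_closed_subset[OF cycle])
    show "u \<in> {v\<in>C. \<exists>w. {v, w} \<in> Z}" using uw Z(2) by auto
    fix x y assume "x \<in> {v\<in>C. \<exists>w. {v, w} \<in> Z}" "y \<in> C" "E x y"
    then have "{x, y} \<in> Z" using all[of x _ y] by auto
    then show "y \<in> {v\<in>C. \<exists>w. {v, w} \<in> Z}" using \<open>y \<in> C\<close> by (auto simp: insert_commute)
  qed blast
  then have "{v, w'} \<in> Z" if "{v, w'} \<in> edges_in C" for v w'
    using all[OF _ that] that by auto
  moreover have "\<exists>v w'. e = {v, w'}" if "e \<in> edges_in C" for e
    using that unfolding edges_of_def by blast
  ultimately show ?thesis using Z(2) by blast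
qed

lemma chordless_closed_walk_cycle_enum:
  assumes n_ge_3: "3 \<le> n" and inj: "inj_on p {..<n}" and closed: "p n = p 0"
    and adj: "\<And>k. k < n \<Longrightarrow> E (p k) (p (Suc k))"
    and chordless: "\<And>s t. s < t \<Longrightarrow> t < n \<Longrightarrow> E (p s) (p t) \<Longrightarrow> t = Suc s \<or> s = 0 \<and> t = n - 1"
  shows "cycle_enum (\<lambda>i. p (nat (i mod int n))) n"
proof -
  let ?r = "\<lambda>i. nat (i mod int n)"
  let ?next = "\<lambda>s. if Suc s = n then 0 else Suc s"
  have r: "?r i < n" for i using n_ge_3 by (simp add: nat_less_iff)
  have "p (?r i) = p (?r j) \<longleftrightarrow> ?r i = ?r j" for i j
    using inj_on_eq_iff[OF inj] r by simp
  then have eq: "p (?r i) = p (?r j) \<longleftrightarrow> [i = j] (mod int n)" for i j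
    using n_ge_3 by (simp add: cong_def eq_nat_nat_iff)
  have next_iff: "?r j = ?next (?r i) \<longleftrightarrow> [j = i + 1] (mod int n)" for i j
  proof -
    have "int (?next (?r i)) = int (Suc (?r i) mod n)"
      using r[of i] by auto
    also have "\<dots> = (i + 1) mod int n"
      using n_ge_3 by (simp add: zmod_int add.commute mod_add_right_eq)
    finally have "int (?next (?r i)) = (i + 1) mod int n" .
    moreover have "int (?r j) = j mod int n" using n_ge_3 by simp
    moreover have "?r j = ?next (?r i) \<longleftrightarrow> int (?r j) = int (?next (?r i))"
      by (rule of_nat_eq_iff[symmetric])
    ultimately show ?thesis unfolding cong_def by (simp only:)
  qed
  have "E (p s) (p t) \<longleftrightarrow> t = ?next s \<or> s = ?next t" if "s < n" "t < n" for s t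
  proof
    show "t = ?next s \<or> s = ?next t" if st: "E (p s) (p t)"
    proof (rule linorder_cases[of s t])
      assume "s < t"
      then show ?thesis using chordless[of s t] st \<open>t < n\<close> by (auto split: if_splits)
    next
      assume "t < s"
      then show ?thesis using chordless[of t s] adj_sym[OF st] \<open>s < n\<close> by (auto split: if_splits)
    qed (use st adj_irrefl in auto)
    have step: "E (p s) (p (?next s))" if "s < n" for s
      using adj[OF that] closed by auto
    show "E (p s) (p t)" if "t = ?next s \<or> s = ?next t"
      using that step[OF \<open>s < n\<close>] step[OF \<open>t < n\<close>] adj_sym by blast
  qed
  then show ?thesis
    unfolding cycle_enum_def using n_ge_3 r eq next_iff by simp
qed

text \<open>A shortest closed walk with property \<open>Q\<close> has neither a repeated vertex nor a chord, as both would split it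
  into two shorter closed walks, one of which has property \<open>Q\<close>.\<close>

context
  fixes W :: "'a set" and Q :: "'a set set \<Rightarrow> bool" and n :: nat
    and p :: "nat \<Rightarrow> 'a" and S :: "nat \<Rightarrow> 'a set set"
  assumes Q_empty: "\<not> Q {}"
    and Q_sym_diff: "\<And>Y Z. even_edge_set Y \<Longrightarrow> even_edge_set Z \<Longrightarrow> Q (Y \<triangle> Z) \<Longrightarrow> Q Y \<or> Q Z"
    and shortest: "\<And>m x Y. walk (adj_in W) x m Y x \<Longrightarrow> Q Y \<Longrightarrow> n \<le> m"
    and closed: "p n = p 0" "S 0 = {}" "Q (S n)"
    and steps: "\<And>k. k < n \<Longrightarrow> adj_in W (p k) (p (Suc k)) \<and> S (Suc k) = S k \<triangle> {{p k, p (Suc k)}}"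
begin

lemma shortest_closed_walk_segment:
  assumes "i \<le> j" "j \<le> n"
  shows "walk (adj_in W) (p i) (j - i) (S i \<triangle> S j) (p j)"
  using walk_segment[of n "adj_in W" p S i "j - i", OF steps] assms by simp

lemma shortest_closed_walk_detour:
  assumes ij: "i \<le> j" "j \<le> n"
    and detour: "walk (adj_in W) (p i) l B (p j)" "walk (adj_in W) (p j) l B (p i)"
  shows "j \<le> i + l \<or> n + i \<le> j + l"
proof -
  have Y: "walk (adj_in W) (p i) (j - i + l) (S i \<triangle> S j \<triangle> B) (p i)"
    by (rule walk_append[OF shortest_closed_walk_segment[OF ij] detour(2)])
  have "walk (adj_in W) (p 0) i (S i) (p i)"
    using shortest_closed_walk_segment[of 0 i] ij closed(2) by simp
  then have "walk (adj_in W) (p 0) (i + l) (S i \<triangle> B) (p j)"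
    using detour(1) by (rule walk_append)
  moreover have "walk (adj_in W) (p j) (n - j) (S j \<triangle> S n) (p 0)"
    using shortest_closed_walk_segment[of j n] ij closed(1) by simp
  ultimately have Z: "walk (adj_in W) (p 0) (i + l + (n - j)) (S i \<triangle> B \<triangle> (S j \<triangle> S n)) (p 0)"
    by (rule walk_append)
  have "S n = (S i \<triangle> S j \<triangle> B) \<triangle> (S i \<triangle> B \<triangle> (S j \<triangle> S n))"
    unfolding set_eq_iff sym_diff_iff by blast
  then have "Q (S i \<triangle> S j \<triangle> B) \<or> Q (S i \<triangle> B \<triangle> (S j \<triangle> S n))"
    using Q_sym_diff[OF closed_walk_even[OF Y] closed_walk_even[OF Z]] closed(3) by simp
  then have "n \<le> j - i + l \<or> n \<le> i + l + (n - j)"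
    using shortest[OF Y] shortest[OF Z] by blast
  then show ?thesis using ij by linarith
qed

lemma shortest_closed_walk_cycle_enum: "cycle_enum (\<lambda>i. p (nat (i mod int n))) n"
proof (rule chordless_closed_walk_cycle_enum)
  have "walk (adj_in W) (p 0) n (S n) (p 0)"
    using shortest_closed_walk_segment[of 0 n] closed(1,2) by simp
  then show "3 \<le> n"
    using closed_walk_short[OF _ _ irreflp_adj_in] Q_empty closed(3) by (metis linorder_not_less)
  show "inj_on p {..<n}"
  proof (rule linorder_inj_onI')
    fix i j assume ij: "i \<in> {..<n}" "j \<in> {..<n}" "i < j"
    show "p i \<noteq> p j"
      using shortest_closed_walk_detour[of i j 0 "{}"] ij walk_0[of "adj_in W" "p j"] by auto
  qed
  fix s t assume st: "s < t" "t < n" "E (p s) (p t)"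
  then have "adj_in W (p s) (p t)" "adj_in W (p t) (p s)"
    using steps[of s] steps[of t] adj_sym unfolding adj_in_def by auto
  then show "t = Suc s \<or> s = 0 \<and> t = n - 1"
    using shortest_closed_walk_detour[of s t "Suc 0" "{{p s, p t}}"] st walk_edge
    by (fastforce simp: insert_commute)
qed (use steps closed(1) in \<open>auto simp: adj_in_def\<close>)

lemma shortest_closed_walk_induced_cycle: "\<exists>C. induced_cycle C \<and> C \<subseteq> W \<and> edges_in C = S n"
proof (intro exI conjI)
  define c where "c i = p (nat (i mod int n))" for i
  have enum: "cycle_enum c n"
    unfolding c_def[abs_def] by (rule shortest_closed_walk_cycle_enum)
  then show cycle: "induced_cycle (range c)" unfolding induced_cycle_def by blast
  have n_pos: "0 < n" using enum unfolding cycle_enum_def by simp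
  then show "range c \<subseteq> W"
    using steps unfolding c_def adj_in_def by (auto simp: nat_less_iff)
  have "p k = c (int k)" if "k < n" for k
    using that unfolding c_def by simp
  then have on_cycle: "p k \<in> range c" if "k \<le> n" for k
    using that closed(1) n_pos by (cases "k = n") auto
  have "S k \<subseteq> edges_in (range c)" if "k \<le> n" for k
    using that
  proof (induction k)
    case (Suc k)
    then have "{p k, p (Suc k)} \<in> edges_in (range c)"
      using steps[of k] on_cycle[of k] on_cycle[of "Suc k"] by (simp add: adj_in_def)
    then show ?case using steps[of k] Suc by auto
  qed (simp add: closed(2))
  moreover have "even_edge_set (S n)"
    using closed_walk_even shortest_closed_walk_segment[of 0 n] closed(1,2) by simp
  moreover have "S n \<noteq> {}" using Q_empty closed(3) by auto
  ultimately show "edges_in (range c) = S n"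
    using even_subset_edges_in[OF cycle] by blast
qed

end

text \<open>Equivalently, modulo 2 the edge set of a closed walk within \<open>W\<close> is a sum of induced cycles within \<open>W\<close>.\<close>

lemma induced_cycle_of_closed_walk:
  assumes "walk (adj_in W) x m Y x" "Q Y" and "\<not> Q {}"
    and Q: "\<And>Y Z. even_edge_set Y \<Longrightarrow> even_edge_set Z \<Longrightarrow> Q (Y \<triangle> Z) \<Longrightarrow> Q Y \<or> Q Z"
  shows "\<exists>C. induced_cycle C \<and> C \<subseteq> W \<and> Q (edges_in C)"
proof -
  let ?closed = "\<lambda>n. \<exists>x Z. walk (adj_in W) x n Z x \<and> Q Z"
  have "?closed m" using assms(1,2) by blast
  then obtain n x Z where walk: "walk (adj_in W) x n Z x" and QZ: "Q Z"
    and "\<And>m. ?closed m \<Longrightarrow> n \<le> m"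
    using LeastI[of ?closed] Least_le[of ?closed] by meson
  then have shortest: "n \<le> m" if "walk (adj_in W) y m Y y" "Q Y" for m y Y
    using that by blast
  obtain p S where p: "p 0 = x" "p n = x" "S 0 = {}" "S n = Z"
    and steps: "\<And>i. i < n \<Longrightarrow> adj_in W (p i) (p (Suc i)) \<and> S (Suc i) = S i \<triangle> {{p i, p (Suc i)}}"
    using walk_prefixes[OF walk] by blast
  have closed: "p n = p 0" "Q (S n)" using QZ p by simp_all
  have "\<exists>C. induced_cycle C \<and> C \<subseteq> W \<and> edges_in C = S n"
    by (rule shortest_closed_walk_induced_cycle[where Q = Q, OF \<open>\<not> Q {}\<close> Q
          shortest closed(1) p(3) closed(2) steps])
  then show ?thesis using closed(2) by auto
qed

section \<open>Components and attachments\<close>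

definition component :: "'a set \<Rightarrow> 'a \<Rightarrow> 'a set" where
  "component C k = {w. (adj_in (- C))\<^sup>*\<^sup>* k w}"

definition attachments :: "'a set \<Rightarrow> 'a \<Rightarrow> 'a set" where
  "attachments C k = {a\<in>C. \<exists>x\<in>component C k. E x a}"

lemma attachments_subset: "attachments C k \<subseteq> C"
  unfolding attachments_def by blast

lemma component_refl: "k \<in> component C k"
  unfolding component_def by simp

lemma component_disjoint: "k \<notin> C \<Longrightarrow> component C k \<inter> C = {}"
  unfolding component_def adj_in_def by (auto elim: rtranclp.cases)

lemma component_step:
  assumes "k \<notin> C" "x \<in> component C k" "E x y"
  shows "y \<in> component C k \<union> attachments C k"
proof (cases "y \<in> C")
  case True
  then show ?thesis using assms(2,3) unfolding attachments_def by blast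
next
  case False
  then have "adj_in (- C) x y"
    using assms component_disjoint[OF assms(1)] unfolding adj_in_def by blast
  then show ?thesis
    using assms(2) unfolding component_def by (auto intro: rtranclp.rtrancl_into_rtrancl)
qed

lemma component_least:
  assumes "k \<in> K" "\<And>x y. x \<in> K \<Longrightarrow> E x y \<Longrightarrow> y \<notin> C \<Longrightarrow> y \<in> K"
  shows "component C k \<subseteq> K"
proof
  fix x assume "x \<in> component C k"
  then have "(adj_in (- C))\<^sup>*\<^sup>* k x" unfolding component_def by simp
  then show "x \<in> K"
    by (induction rule: rtranclp_induct) (use assms in \<open>auto simp: adj_in_def\<close>)
qed

lemma component_subset_vertices: "k \<in> V \<Longrightarrow> component C k \<subseteq> V"
  by (rule component_least) (blast intro: adj_vertices)+

lemma symp_adj_in_rtranclp: "(adj_in W)\<^sup>*\<^sup>* x y \<Longrightarrow> (adj_in W)\<^sup>*\<^sup>* y x"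
  by (rule sympD[OF symp_rtranclp]) (auto intro!: sympI simp: adj_in_def adj_sym)

lemma component_connected:
  assumes "x \<in> component C k" "y \<in> component C k"
  shows "(adj_in (component C k))\<^sup>*\<^sup>* x y"
proof -
  have from_k: "(adj_in (component C k))\<^sup>*\<^sup>* k z" if "z \<in> component C k" for z
  proof -
    have "(adj_in (- C))\<^sup>*\<^sup>* k z" using that unfolding component_def by simp
    then show ?thesis
    proof (induction rule: rtranclp_induct)
      case (step y z)
      then have "y \<in> component C k" "z \<in> component C k"
        unfolding component_def by (auto intro: rtranclp.rtrancl_into_rtrancl)
      then have "adj_in (component C k) y z"
        using step.hyps(2) unfolding adj_in_def by blast
      then show ?case by (rule rtranclp.rtrancl_into_rtrancl[OF step.IH])
    qed simp
  qed
  show ?thesis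
    using rtranclp_trans[OF symp_adj_in_rtranclp[OF from_k[OF assms(1)]] from_k[OF assms(2)]] .
qed

lemma attachment_link:
  assumes k_notin: "k \<notin> C" and a_in: "a \<in> attachments C k"
  obtains J where "J \<subseteq> edges" "odd_vertices J = {k, a}"
    "\<And>v w. v \<in> C \<Longrightarrow> v \<noteq> a \<Longrightarrow> {v, w} \<notin> J"
proof -
  obtain x where x: "x \<in> component C k" "E x a" and aC: "a \<in> C"
    using a_in unfolding attachments_def by blast
  then obtain P where P: "P \<subseteq> edges_in (- C)" "odd_vertices P = {k} \<triangle> {x}"
    using path_edge_set[of "- C" k x] unfolding component_def by blast
  then have "P \<subseteq> edges" using edges_in_subset_edges by blast
  have "x \<notin> C" using component_disjoint[OF k_notin] x(1) by blast
  have "odd_vertices (P \<triangle> {{x, a}}) = ({k} \<triangle> {x}) \<triangle> {x, a}"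
    using odd_vertices_sym_diff[OF finite_subset[OF \<open>P \<subseteq> edges\<close> finite_edges], of "{{x, a}}"]
      odd_vertices_edge[of x a] x(2) adj_irrefl P(2) by auto
  also have "\<dots> = {k, a}" using k_notin aC \<open>x \<notin> C\<close> by auto
  finally have odd: "odd_vertices (P \<triangle> {{x, a}}) = {k, a}" .
  have sub: "P \<triangle> {{x, a}} \<subseteq> edges" using \<open>P \<subseteq> edges\<close> x(2) by auto
  have untouched: "{v, w} \<notin> P \<triangle> {{x, a}}" if "v \<in> C" "v \<noteq> a" for v w
    using P(1) that \<open>x \<notin> C\<close> by (auto simp: doubleton_eq_iff)
  show ?thesis by (rule that[OF sub odd untouched])
qed

lemma induced_cycle_minus_clique_connected:
  assumes cycle: "induced_cycle C" and clique: "\<And>a b. a \<in> A \<inter> C \<Longrightarrow> b \<in> A \<inter> C \<Longrightarrow> a = b \<or> E a b"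
    and xy: "x \<in> C - A" "y \<in> C - A"
  shows "(adj_in (C - A))\<^sup>*\<^sup>* x y"
proof (cases "A \<inter> C = {}")
  case True
  then have "C - A = C" by blast
  then show ?thesis using induced_cycle_connected[OF cycle] xy by simp
next
  case False
  let ?n = "int (card C)"
  obtain a where a: "a \<in> A" "a \<in> C" using False by blast
  then obtain c where enum: "cycle_enum c (card C)" "range c = C" "c 0 = a"
    using induced_cycle_enum_from[OF cycle] by metis
  have eq: "c i = c j \<longleftrightarrow> i = j" if "0 \<le> i" "i < ?n" "0 \<le> j" "j < ?n" for i j
    using bij_betw_imp_inj_on[OF bij_betw_cycle_enum[OF enum(1)]] that by (auto dest: inj_onD)
  have ends: "k \<in> {0, 1, ?n - 1}" if k: "c k \<in> A" "0 \<le> k" "k < ?n" for k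
  proof -
    have "c k = a \<or> c k \<in> {w\<in>C. E (c 0) w}" using clique[of a "c k"] k(1) a enum(2,3) by auto
    moreover have "c (- 1) = c (?n - 1)"
      using enum(1) unfolding cycle_enum_def by (simp add: cong_iff_dvd_diff)
    ultimately have "c k \<in> {c 0, c 1, c (?n - 1)}"
      using cycle_enum_neighbours(1)[OF enum(1), of 0] enum(2,3) by auto
    then show ?thesis
      using k(2,3) eq[of k 0] eq[of k 1] eq[of k "?n - 1"] induced_cycle_card_ge[OF cycle] by auto
  qed
  have path: "(adj_in (C - A))\<^sup>*\<^sup>* (c i) (c j)"
    if ij: "0 \<le> i" "i \<le> j" "j < ?n" "c i \<notin> A" "c j \<notin> A" for i j
  proof (rule cycle_enum_segment_connected[OF enum(1) ij(2)])
    fix k assume k: "i \<le> k" "k \<le> j"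
    have "i \<noteq> 0" using ij(4) a(1) enum(3) by metis
    have "c k \<notin> A"
    proof
      assume "c k \<in> A"
      then have "k = i \<or> k = j" using ends[of k] k ij(1,3) \<open>i \<noteq> 0\<close> by auto
      then show False using ij(4,5) \<open>c k \<in> A\<close> by blast
    qed
    then show "c k \<in> C - A" using enum(2) by blast
  qed
  obtain i where i: "0 \<le> i" "i < ?n" "c i = x" using cycle_enum_index[OF enum(1)] xy(1) enum(2) by blast
  obtain j where j: "0 \<le> j" "j < ?n" "c j = y" using cycle_enum_index[OF enum(1)] xy(2) enum(2) by blast
  show ?thesis
    using path[of i j] symp_adj_in_rtranclp[OF path[of j i]] i j xy by (cases "i \<le> j") auto
qed

lemma even_edge_set_link:
  assumes "Y \<subseteq> edges" "J \<subseteq> edges" "J' \<subseteq> edges"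
    and odd: "odd_vertices Y = {x, y}" "odd_vertices J = {k, x}" "odd_vertices J' = {k, y}"
    and ne: "k \<noteq> x" "k \<noteq> y" "x \<noteq> y"
  shows "even_edge_set (Y \<triangle> (J \<triangle> J'))"
proof -
  have fin: "finite Y" "finite J" "finite J'"
    using assms(1-3) finite_subset[OF _ finite_edges] by blast+
  have "odd_vertices (J \<triangle> J') = {x, y}"
    unfolding odd_vertices_sym_diff[OF fin(2,3)] odd using ne by auto
  then have "odd_vertices (Y \<triangle> (J \<triangle> J')) = {}"
    using odd_vertices_sym_diff[of Y "J \<triangle> J'"] fin odd(1) by simp
  then show ?thesis using assms(1-3) unfolding even_edge_set_def by blast
qed

lemma adjacent_if_arc_spans_cycle:
  assumes cycle: "induced_cycle C" and a_in: "a \<in> C"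
    and Y: "Y \<subseteq> edges_in C" "odd_vertices Y = {a, b}"
    and spans: "\<And>v. v \<in> C - {a, b} \<Longrightarrow> \<exists>x. {v, x} \<in> Y"
  shows "E a b"
proof -
  have "\<not> {w\<in>C. E a w} \<subseteq> {w. {a, w} \<in> Y}"
  proof
    assume "{w\<in>C. E a w} \<subseteq> {w. {a, w} \<in> Y}"
    then have "{w. {a, w} \<in> Y} = {w\<in>C. E a w}" using Y(1) by auto
    then have "a \<notin> odd_vertices Y"
      unfolding odd_vertices_def by (simp add: card_induced_cycle_neighbours[OF cycle a_in])
    then show False using Y(2) by blast
  qed
  then obtain w where w: "w \<in> C" "E a w" "{a, w} \<notin> Y" by blast
  then have aw: "{w, a} \<in> edges_in C" "{w, a} \<notin> Y" "w \<noteq> a"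
    using a_in adj_sym adj_irrefl by (auto simp: insert_commute)
  have "w = b"
  proof (rule ccontr)
    assume "w \<noteq> b"
    then have "w \<in> C - {a, b}" using w(1) aw(3) by blast
    then obtain x where "{w, x} \<in> Y" using spans by blast
    then show False
      using even_at_cycle_vertex[OF cycle Y(1) _ _ aw(1)] Y(2) aw(2,3) \<open>w \<noteq> b\<close> by blast
  qed
  then show ?thesis using w(2) by blast
qed

end

section \<open>Even edge sets as boundaries of regions\<close>

locale connected_simple_graph = simple_graph +
  assumes connected: "connected_graph V E"
begin

lemma vertices_nonempty: "V \<noteq> {}"
  and reachable: "u \<in> V \<Longrightarrow> v \<in> V \<Longrightarrow> E\<^sup>*\<^sup>* u v"
  using connected unfolding connected_graph_def by blast+

lemma ex_edge_set_odd_vertices: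
  assumes v_in: "v \<in> V" and A: "finite A" "A \<subseteq> V - {v}"
  shows "\<exists>P. P \<subseteq> edges \<and> odd_vertices P - {v} = A"
  using A
proof (induction A rule: finite_induct)
  case empty
  show ?case by (intro exI[of _ "{}"]) simp
next
  case (insert a A)
  then obtain P where P: "P \<subseteq> edges" "odd_vertices P - {v} = A" by blast
  obtain Q where Q: "Q \<subseteq> edges" "odd_vertices Q = {v} \<triangle> {a}"
    using path_edge_set[of UNIV v a] reachable[OF v_in, of a] insert.prems adj_in_UNIV by auto
  have "odd_vertices (P \<triangle> Q) = odd_vertices P \<triangle> ({v} \<triangle> {a})"
    using odd_vertices_sym_diff P Q finite_subset[OF _ finite_edges] by metis
  then have "odd_vertices (P \<triangle> Q) - {v} = insert a A" using P insert by blast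
  then show ?case using P Q by (intro exI[of _ "P \<triangle> Q"]) blast
qed

lemma card_even_edge_sets_le: "card {Z. even_edge_set Z} * 2 ^ (card V - 1) \<le> 2 ^ card edges"
proof -
  obtain v where v: "v \<in> V" using vertices_nonempty by blast
  have "\<forall>A\<in>Pow (V - {v}). \<exists>P. P \<subseteq> edges \<and> odd_vertices P - {v} = A"
    using ex_edge_set_odd_vertices[OF v] finite_vertices by (meson PowD finite_Diff finite_subset)
  then obtain J where J: "\<And>A. A \<in> Pow (V - {v}) \<Longrightarrow> J A \<subseteq> edges \<and> odd_vertices (J A) - {v} = A"
    by metis
  let ?f = "\<lambda>(Z, A). Z \<triangle> J A"
  let ?X = "{Z. even_edge_set Z} \<times> Pow (V - {v})"
  have odd: "odd_vertices (?f (Z, A)) - {v} = A" if "even_edge_set Z" "A \<in> Pow (V - {v})" for Z A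
  proof -
    have "finite Z" "finite (J A)"
      using that J[of A] finite_subset[OF _ finite_edges] unfolding even_edge_set_def by blast+
    then show ?thesis
      using that J[of A] odd_vertices_sym_diff[of Z "J A"] unfolding even_edge_set_def by auto
  qed
  have "inj_on ?f ?X"
  proof (rule inj_onI, clarify)
    fix Z A Z' A' assume ZA: "even_edge_set Z" "even_edge_set Z'" "A \<subseteq> V - {v}" "A' \<subseteq> V - {v}"
      "Z \<triangle> J A = Z' \<triangle> J A'"
    then have "A = A'" using odd[of Z A] odd[of Z' A'] by auto
    then show "Z = Z' \<and> A = A'" using ZA(5) by blast
  qed
  moreover have "?f (Z, A) \<subseteq> edges" if "even_edge_set Z" "A \<in> Pow (V - {v})" for Z A
    using that J[of A] unfolding even_edge_set_def by auto
  then have "?f ` ?X \<subseteq> Pow edges" by blast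
  ultimately have "card ?X \<le> card (Pow edges)"
    using card_inj_on_le finite_edges by blast
  then show ?thesis using v finite_vertices finite_edges by (simp add: card_cartesian_product card_Pow)
qed

end

locale rotation_graph = simple_graph +
  fixes \<sigma> :: "'a \<Rightarrow> 'a \<Rightarrow> 'a"
  assumes rotation: "rotation_system V E \<sigma>"
begin

abbreviation D :: "('a \<times> 'a) set" where
  "D \<equiv> darts V E"

abbreviation \<phi> :: "'a \<times> 'a \<Rightarrow> 'a \<times> 'a" where
  "\<phi> \<equiv> face_step \<sigma>"

abbreviation face :: "'a \<times> 'a \<Rightarrow> ('a \<times> 'a) set" where
  "face \<equiv> face_of \<sigma>"

definition face_closed :: "('a \<times> 'a) set \<Rightarrow> bool" where
  "face_closed X \<longleftrightarrow> X \<subseteq> D \<and> (\<forall>d\<in>D. \<phi> d \<in> X \<longleftrightarrow> d \<in> X)"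

lemma darts_iff [simp]: "(u, v) \<in> D \<longleftrightarrow> E u v"
  using adj_vertices unfolding darts_def by auto

lemma finite_darts: "finite D"
  by (rule finite_subset[of D "V \<times> V"]) (auto simp: finite_vertices darts_def)

lemma card_darts: "card D = 2 * card edges"
proof -
  let ?e = "\<lambda>d. {fst d, snd d}"
  have img: "?e ` D = edges" unfolding edges_of_def image_def by (auto simp: Bex_def)
  have "card D = (\<Sum>e\<in>?e ` D. card {d\<in>D. ?e d = e})"
    using sum.image_gen[OF finite_darts, of "\<lambda>_. 1::nat" ?e] by simp
  also have "\<dots> = (\<Sum>e\<in>?e ` D. 2)"
  proof (rule sum.cong[OF refl])
    fix e assume "e \<in> ?e ` D"
    then obtain u v where e: "E u v" "e = {u, v}" unfolding img edges_of_def by blast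
    then have "{d\<in>D. ?e d = e} = {(u, v), (v, u)}"
      using adj_sym by (auto simp: doubleton_eq_iff)
    moreover have "u \<noteq> v" using e adj_irrefl by auto
    ultimately show "card {d\<in>D. ?e d = e} = 2" by simp
  qed
  finally show ?thesis using img by simp
qed

lemma bij_betw_rotation: "v \<in> V \<Longrightarrow> bij_betw (\<sigma> v) {w. E v w} {w. E v w}"
  using rotation unfolding rotation_system_def nbrs_def by simp

lemma rotation_adj: "E v w \<Longrightarrow> E v (\<sigma> v w)"
  using bij_betw_apply[OF bij_betw_rotation, of v w] adj_vertices by simp

lemma rotation_induct:
  assumes "E v w" "P w" "\<And>x. E v x \<Longrightarrow> P x \<Longrightarrow> P (\<sigma> v x)" "E v w'"
  shows "P w'"
proof -
  have "E v ((\<sigma> v ^^ k) w) \<and> P ((\<sigma> v ^^ k) w)" for k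
    by (induction k) (use assms rotation_adj in auto)
  moreover obtain n where "(\<sigma> v ^^ n) w = w'"
    using rotation assms(1,4) adj_vertices unfolding rotation_system_def nbrs_def by blast
  ultimately show ?thesis by blast
qed

lemma bij_betw_face_step: "bij_betw \<phi> D D"
proof -
  have "\<phi> ` D \<subseteq> D"
    using rotation_adj adj_sym unfolding face_step_def by auto
  moreover have "inj_on \<phi> D"
  proof (rule inj_onI, clarify)
    fix u v u' v' assume d: "(u, v) \<in> D" "(u', v') \<in> D" and "\<phi> (u, v) = \<phi> (u', v')"
    then have "v = v'" "\<sigma> v u = \<sigma> v u'" unfolding face_step_def by auto
    then show "u = u' \<and> v = v'"
      using d adj_sym adj_vertices bij_betw_imp_inj_on[OF bij_betw_rotation, of v] by (auto dest: inj_onD)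
  qed
  ultimately show ?thesis
    using finite_darts endo_inj_surj unfolding bij_betw_def by blast
qed

lemma dart_in_orbit:
  assumes "d \<in> D"
  shows "d \<in> orbit \<phi> d"
proof -
  let ?\<pi> = "perm_restrict \<phi> D"
  have "bij_betw ?\<pi> D D"
    using bij_betw_face_step by (simp add: perm_restrict_simps cong: bij_betw_cong)
  then have "?\<pi> permutes D"
    by (rule bij_imp_permutes) (simp add: perm_restrict_simps)
  then have "permutation ?\<pi>"
    using finite_darts permutation_permutes by blast
  then have "d \<in> orbit ?\<pi> d"
    by (rule permutation_self_in_orbit)
  also have "orbit ?\<pi> d = orbit \<phi> d"
    by (rule orbit_cong0[OF assms bij_betw_imp_funcset[OF bij_betw_face_step], symmetric])
      (simp add: perm_restrict_simps)
  finally show ?thesis .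
qed

lemma face_eq_orbit: "d \<in> D \<Longrightarrow> face d = orbit \<phi> d"
  using orbit_altdef_self_in[OF dart_in_orbit] unfolding face_of_def by simp

lemma face_refl: "d \<in> D \<Longrightarrow> d \<in> face d"
  by (simp add: face_eq_orbit dart_in_orbit)

lemma face_subset_darts:
  assumes "d \<in> D"
  shows "face d \<subseteq> D"
proof
  fix d' assume "d' \<in> face d"
  then have "d' \<in> orbit \<phi> d" using face_eq_orbit[OF assms] by simp
  then show "d' \<in> D"
    by induction (use assms bij_betw_apply[OF bij_betw_face_step] in auto)
qed

lemma face_eqI:
  assumes "d \<in> D" "d' \<in> face d"
  shows "face d' = face d"
proof -
  have "cyclic_on \<phi> (face d)"
    unfolding cyclic_on_def using face_refl face_eq_orbit assms(1) by blast
  then have "orbit \<phi> d' = face d" using assms(2) by (rule orbit_cyclic_eq3)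
  moreover have "d' \<in> D" using face_subset_darts assms by blast
  ultimately show ?thesis using face_eq_orbit by simp
qed

lemma face_of_mem: "f \<in> faces V E \<sigma> \<Longrightarrow> d \<in> f \<Longrightarrow> f = face d"
  using face_eqI unfolding faces_def by blast

lemma face_nonempty: "f \<in> faces V E \<sigma> \<Longrightarrow> f \<noteq> {}"
  using face_refl unfolding faces_def by blast

lemma face_subset: "f \<in> faces V E \<sigma> \<Longrightarrow> f \<subseteq> D"
  using face_subset_darts unfolding faces_def by blast

lemma finite_faces: "finite (faces V E \<sigma>)"
  using finite_darts unfolding faces_def by simp

lemma face_closed_face:
  assumes "f \<in> faces V E \<sigma>"
  shows "face_closed f"
proof -
  have "face (\<phi> d) = face d" if "d \<in> D" for d
    by (rule face_eqI[OF that]) (simp add: face_eq_orbit that orbit.base)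
  then have "\<phi> d \<in> f \<longleftrightarrow> d \<in> f" if "d \<in> D" for d
    using that face_of_mem[OF assms] face_refl bij_betw_apply[OF bij_betw_face_step] by metis
  then show ?thesis using face_subset[OF assms] unfolding face_closed_def by blast
qed

lemma face_closed_Union: "S \<subseteq> faces V E \<sigma> \<Longrightarrow> face_closed (\<Union>S)"
  using face_closed_face unfolding face_closed_def by (meson UnionE UnionI Union_least subsetD)

lemma face_closed_contains_face:
  assumes "face_closed X" "d \<in> X"
  shows "face d \<subseteq> X"
proof
  have d_in: "d \<in> D" using assms unfolding face_closed_def by blast
  fix d' assume "d' \<in> face d"
  then have "d' \<in> orbit \<phi> d" using face_eq_orbit[OF d_in] by simp
  then show "d' \<in> X"
    by induction (use assms d_in in \<open>auto simp: face_closed_def\<close>)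
qed

lemma face_closed_rotation:
  assumes "face_closed X" "E v w"
  shows "(v, \<sigma> v w) \<in> X \<longleftrightarrow> (w, v) \<in> X"
proof -
  have "(w, v) \<in> D" using adj_sym[OF assms(2)] by simp
  then have "\<phi> (w, v) \<in> X \<longleftrightarrow> (w, v) \<in> X" using assms(1) unfolding face_closed_def by blast
  then show ?thesis unfolding face_step_def by simp
qed

lemma boundary_subset_edges: "X \<subseteq> D \<Longrightarrow> boundary X \<subseteq> edges"
  unfolding boundary_def darts_def by auto

lemma boundary_even:
  assumes X: "face_closed X"
  shows "even_edge_set (boundary X)"
proof -
  have sub: "boundary X \<subseteq> edges"
    using X boundary_subset_edges unfolding face_closed_def by blast
  have "even (card {w. {v, w} \<in> boundary X})" for v
  proof (cases "v \<in> V")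
    case True
    have "{v, w} \<in> boundary X \<longleftrightarrow> E v w \<and> ((v, w) \<in> X \<longleftrightarrow> \<not> (v, \<sigma> v w) \<in> X)" for w
      using face_closed_rotation[OF X, of v w] sub edges_iff[of v w] boundary_iff[of v w X] by blast
    then show ?thesis
      using even_card_disagreements_permutation[OF finite_neighbours bij_betw_rotation[OF True],
          of "\<lambda>w. (v, w) \<in> X"] by simp
  next
    case False
    then have "{w. {v, w} \<in> boundary X} = {}" using sub adj_vertices by auto
    then show ?thesis by simp
  qed
  then show ?thesis using sub unfolding even_edge_set_def odd_vertices_def by simp
qed

lemma face_walk:
  assumes d_in: "d \<in> D"
  shows "\<exists>n. walk E (fst d) n (boundary (face d)) (fst d)"
proof -
  let ?d = "\<lambda>k. (\<phi> ^^ k) d" and ?n = "funpow_dist1 \<phi> d d"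
  have in_D: "?d k \<in> D" for k
    by (induction k) (use d_in bij_betw_apply[OF bij_betw_face_step] in auto)
  have "k \<le> ?n \<Longrightarrow> walk E (fst d) k (boundary (?d ` {0..<k})) (fst (?d k))" for k
  proof (induction k)
    case (Suc k)
    obtain u v where uv: "?d k = (u, v)" by fastforce
    then have "E u v" using in_D[of k] by simp
    then have "u \<noteq> v" using adj_irrefl by blast
    moreover have "(u, v) \<notin> ?d ` {0..<k}"
      using inj_on_funpow_dist1[OF dart_in_orbit[OF d_in]] Suc.prems uv[symmetric]
      by (auto dest!: inj_onD)
    ultimately have "boundary (insert (u, v) (?d ` {0..<k})) = boundary (?d ` {0..<k}) \<triangle> {{u, v}}"
      by (rule boundary_insert)
    moreover have "?d ` {0..<Suc k} = insert (u, v) (?d ` {0..<k})"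
      using uv by (simp only: atLeast0_lessThan_Suc image_insert)
    moreover have "fst (?d (Suc k)) = v" using uv by (simp add: face_step_def)
    ultimately show ?case
      using walk_Suc[of E "fst d" k _ u v] Suc uv \<open>E u v\<close> by simp
  qed (simp add: walk_0)
  from this[of ?n] show ?thesis
    using orbit_conv_funpow_dist1[OF dart_in_orbit[OF d_in]] funpow_dist1_prop[OF dart_in_orbit[OF d_in]]
      face_eq_orbit[OF d_in] by auto
qed

end

locale plane_graph = connected_simple_graph +
  fixes \<sigma> :: "'a \<Rightarrow> 'a \<Rightarrow> 'a" and Of :: "('a \<times> 'a) set"
  assumes plane: "plane_embedding V E \<sigma>" and outer_face: "Of \<in> faces V E \<sigma>"

sublocale plane_graph \<subseteq> rotation_graph V E \<sigma>
  using plane unfolding plane_embedding_def by unfold_locales blast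

context plane_graph
begin

definition region :: "('a \<times> 'a) set \<Rightarrow> bool" where
  "region X \<longleftrightarrow> face_closed X \<and> X \<inter> Of = {}"

definition inside :: "'a set set \<Rightarrow> ('a \<times> 'a) set" where
  "inside Z = (THE X. region X \<and> boundary X = Z)"

lemma finite_regions: "finite {X. region X}"
  by (rule finite_subset[of _ "Pow D"]) (auto simp: finite_darts region_def face_closed_def)

lemma region_sym_diff: "region X \<Longrightarrow> region Y \<Longrightarrow> region (X \<triangle> Y)"
  unfolding region_def face_closed_def by auto

lemma region_boundary_empty:
  assumes X: "region X" and "boundary X = {}"
  shows "X = {}"
proof (rule ccontr)
  assume "X \<noteq> {}"
  have closed: "face_closed X" using X unfolding region_def by blast
  then obtain u v where uv: "(u, v) \<in> X" "E u v"
    using \<open>X \<noteq> {}\<close> unfolding face_closed_def by (auto simp: darts_def)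
  have flip: "(x, y) \<in> X \<longleftrightarrow> (y, x) \<in> X" for x y
    using assms(2) boundary_iff[of x y X] by simp
  have star: "(x, w') \<in> X" if "(x, w) \<in> X" "E x w" "E x w'" for x w w'
    by (rule rotation_induct[where P = "\<lambda>w. (x, w) \<in> X", OF that(2,1) _ that(3)])
      (use face_closed_rotation[OF closed] flip in blast)
  have "\<forall>w. E x w \<longrightarrow> (x, w) \<in> X" if "E\<^sup>*\<^sup>* u x" for x
    using that
  proof (induction rule: rtranclp_induct)
    case base
    then show ?case using star uv by blast
  next
    case (step x y)
    then show ?case using star[of y x] flip adj_sym by blast
  qed
  moreover obtain a b where ab: "(a, b) \<in> Of" "E a b"
    using face_nonempty[OF outer_face] face_subset[OF outer_face] by (auto simp: darts_def)
  moreover have "E\<^sup>*\<^sup>* u a" using reachable uv(2) ab(2) adj_vertices by blast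
  ultimately show False using X unfolding region_def by blast
qed

lemma inj_on_boundary_regions: "inj_on boundary {X. region X}"
proof (rule inj_onI)
  fix X Y assume XY: "X \<in> {X. region X}" "Y \<in> {X. region X}" "boundary X = boundary Y"
  then have "boundary (X \<triangle> Y) = {}" unfolding boundary_sym_diff by blast
  then have "X \<triangle> Y = {}" using XY by (intro region_boundary_empty region_sym_diff) simp_all
  then show "X = Y" by blast
qed

lemma region_internal_face:
  assumes "f \<in> internal_faces V E \<sigma> Of"
  shows "region f"
proof -
  have f_in: "f \<in> faces V E \<sigma>" "f \<noteq> Of" using assms unfolding internal_faces_def by blast+
  then have "f \<inter> Of = {}" using face_of_mem[OF f_in(1)] face_of_mem[OF outer_face] by blast
  then show ?thesis using face_closed_face[OF f_in(1)] unfolding region_def by blast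
qed

lemma card_regions_ge: "2 ^ (card (faces V E \<sigma>) - 1) \<le> card {X. region X}"
proof -
  let ?I = "internal_faces V E \<sigma> Of"
  have "inj_on Union (Pow ?I)"
  proof (rule inj_onI)
    have sub: "S \<subseteq> T" if ST: "S \<subseteq> ?I" "T \<subseteq> ?I" "\<Union>S = \<Union>T" for S T
    proof
      have faces: "?I \<subseteq> faces V E \<sigma>" unfolding internal_faces_def by blast
      fix f assume "f \<in> S"
      then have f_in: "f \<in> faces V E \<sigma>" using ST(1) faces by blast
      then obtain d where "d \<in> f" using face_nonempty by blast
      then obtain g where g: "g \<in> T" "d \<in> g" using ST(3) \<open>f \<in> S\<close> by blast
      then have "g \<in> faces V E \<sigma>" using ST(2) faces by blast
      then have "f = g" using face_of_mem f_in g(2) \<open>d \<in> f\<close> by metis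
      then show "f \<in> T" using g(1) by simp
    qed
    fix S T assume "S \<in> Pow ?I" "T \<in> Pow ?I" "\<Union>S = \<Union>T"
    then show "S = T" using sub[of S T] sub[of T S] by auto
  qed
  moreover have "region (\<Union>S)" if S: "S \<subseteq> ?I" for S
  proof -
    have "S \<subseteq> faces V E \<sigma>" using S unfolding internal_faces_def by blast
    moreover have "\<Union>S \<inter> Of = {}" using S region_internal_face unfolding region_def by blast
    ultimately show ?thesis using face_closed_Union unfolding region_def by blast
  qed
  then have "Union ` Pow ?I \<subseteq> {X. region X}" by blast
  ultimately have "card (Pow ?I) \<le> card {X. region X}"
    using card_inj_on_le finite_regions by blast
  then show ?thesis
    using finite_faces outer_face unfolding internal_faces_def by (simp add: card_Pow)
qed

text \<open>By Euler's formula there are at most as many even edge sets as regions, so that the injection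
  \<^const>\<open>boundary\<close> from regions to even edge sets is onto: a discrete Jordan curve theorem.\<close>

lemma even_edge_set_is_boundary:
  assumes "even_edge_set Z"
  shows "\<exists>X. region X \<and> boundary X = Z"
proof -
  have "card V > 0" "card (faces V E \<sigma>) > 0"
    using vertices_nonempty finite_vertices finite_faces outer_face by (auto simp: card_gt_0_iff)
  then have "card edges = (card (faces V E \<sigma>) - 1) + (card V - 1)"
    using plane card_darts unfolding plane_embedding_def by linarith
  then have
    "card {Z. even_edge_set Z} * 2 ^ (card V - 1) \<le> 2 ^ (card (faces V E \<sigma>) - 1) * 2 ^ (card V - 1)"
    using card_even_edge_sets_le by (simp add: power_add)
  then have "card {Z. even_edge_set Z} \<le> 2 ^ (card (faces V E \<sigma>) - 1)" by simp
  also have "\<dots> \<le> card (boundary ` {X. region X})"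
    using card_regions_ge card_image[OF inj_on_boundary_regions] by simp
  finally have "card {Z. even_edge_set Z} \<le> card (boundary ` {X. region X})" .
  moreover have "boundary ` {X. region X} \<subseteq> {Z. even_edge_set Z}"
    using boundary_even unfolding region_def by blast
  moreover have "finite {Z. even_edge_set Z}"
    by (rule finite_subset[of _ "Pow edges"]) (auto simp: finite_edges even_edge_set_def)
  ultimately have "boundary ` {X. region X} = {Z. even_edge_set Z}"
    using card_seteq by blast
  then have "Z \<in> boundary ` {X. region X}" using assms by simp
  then show ?thesis by auto
qed

lemma inside_boundary: "region X \<Longrightarrow> inside (boundary X) = X"
  unfolding inside_def using inj_on_boundary_regions by (auto intro!: the_equality dest: inj_onD)

lemma
  assumes "even_edge_set Z"
  shows region_inside: "region (inside Z)" and boundary_inside: "boundary (inside Z) = Z"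
proof -
  obtain X where "region X" "boundary X = Z" using even_edge_set_is_boundary[OF assms] by blast
  then show "region (inside Z)" "boundary (inside Z) = Z" using inside_boundary by auto
qed

lemma inside_empty [simp]: "inside {} = {}"
  using inside_boundary[of "{}"] by (simp add: region_def face_closed_def)

lemma inside_sym_diff:
  assumes "even_edge_set Y" "even_edge_set Z"
  shows "inside (Y \<triangle> Z) = inside Y \<triangle> inside Z"
  using inside_boundary[OF region_sym_diff[OF region_inside[OF assms(1)] region_inside[OF assms(2)]]]
  unfolding boundary_sym_diff boundary_inside[OF assms(1)] boundary_inside[OF assms(2)] .

end

section \<open>Internal faces of outerplanar embeddings\<close>

locale outerplane_graph = plane_graph +
  assumes vertex_on_outer_face: "v \<in> V \<Longrightarrow> \<exists>w. (v, w) \<in> Of"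
begin

lemma dart_inside_incident:
  assumes Z: "even_edge_set Z" and vw: "(v, w) \<in> inside Z"
  shows "\<exists>x. {v, x} \<in> Z"
proof (rule ccontr)
  assume untouched: "\<nexists>x. {v, x} \<in> Z"
  have reg: "face_closed (inside Z)" "inside Z \<inter> Of = {}"
    using region_inside[OF Z] unfolding region_def by blast+
  then have "E v w" using vw unfolding face_closed_def by auto
  then obtain w' where w': "(v, w') \<in> Of" using vertex_on_outer_face adj_vertices by blast
  then have "E v w'" using face_subset[OF outer_face] by auto
  have "(v, w') \<in> inside Z"
  proof (rule rotation_induct[where P = "\<lambda>x. (v, x) \<in> inside Z", OF \<open>E v w\<close> vw _ \<open>E v w'\<close>])
    fix x assume x: "E v x" "(v, x) \<in> inside Z"
    then have "(x, v) \<in> inside Z"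
      using untouched boundary_iff[of v x "inside Z"] unfolding boundary_inside[OF Z] by blast
    then show "(v, \<sigma> v x) \<in> inside Z" using face_closed_rotation[OF reg(1) x(1)] by blast
  qed
  then show False using w' reg(2) by blast
qed

lemma dart_inside_cycle:
  assumes cycle: "induced_cycle C" and uv: "(u, v) \<in> inside (edges_in C)"
  shows "E u v \<and> u \<in> C \<and> v \<in> C"
proof -
  note even = edges_in_even[OF cycle]
  have closed: "face_closed (inside (edges_in C))"
    using region_inside[OF even] unfolding region_def by blast
  then have "E u v" using uv unfolding face_closed_def by auto
  have "(v, \<sigma> v u) \<in> inside (edges_in C)"
    using face_closed_rotation[OF closed adj_sym[OF \<open>E u v\<close>]] uv by blast
  then show ?thesis
    using dart_inside_incident[OF even] uv \<open>E u v\<close> by fastforce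
qed

lemma inside_cycle_internal_face:
  assumes cycle: "induced_cycle C"
  shows "inside (edges_in C) \<in> internal_faces V E \<sigma> Of"
proof -
  let ?X = "inside (edges_in C)"
  note even = edges_in_even[OF cycle]
  have X: "region ?X" "boundary ?X = edges_in C"
    using region_inside[OF even] boundary_inside[OF even] .
  have "edges_in C \<noteq> {}" using card_edges_in[OF cycle] induced_cycle_card_ge[OF cycle] by auto
  then obtain d where d: "d \<in> ?X" using X(2) by fastforce
  then have dD: "d \<in> D" using X(1) unfolding region_def face_closed_def by blast
  have sub: "face d \<subseteq> ?X"
    using face_closed_contains_face d X(1) unfolding region_def by blast
  have "face d \<in> faces V E \<sigma>" using dD unfolding faces_def by blast
  moreover have "face d \<noteq> Of"
    using sub d face_refl[OF dD] X(1) unfolding region_def by blast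
  ultimately have internal: "face d \<in> internal_faces V E \<sigma> Of"
    unfolding internal_faces_def by blast
  note reg = region_internal_face[OF this]
  have "boundary (face d) \<subseteq> edges_in C"
    using sub dart_inside_cycle[OF cycle] unfolding boundary_def by fastforce
  moreover have "boundary (face d) \<noteq> {}"
    using region_boundary_empty[OF reg] face_refl[OF dD] by blast
  ultimately have "boundary (face d) = edges_in C"
    using even_subset_edges_in[OF cycle boundary_even] reg unfolding region_def by blast
  then have "?X = face d" using inside_boundary[OF reg] by simp
  then show ?thesis using internal by simp
qed

lemma card_inside_cycle:
  assumes cycle: "induced_cycle C"
  shows "card (inside (edges_in C)) = card C"
proof -
  let ?X = "inside (edges_in C)"
  have iff: "{u, v} \<in> edges_in C \<longleftrightarrow> ((u, v) \<in> ?X \<longleftrightarrow> (v, u) \<notin> ?X)" for u v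
    using boundary_iff[of u v ?X] unfolding boundary_inside[OF edges_in_even[OF cycle]] .
  have "bij_betw (\<lambda>(u, v). {u, v}) ?X (edges_in C)"
  proof (rule bij_betw_imageI)
    have "(v, u) \<notin> ?X" if uv: "(u, v) \<in> ?X" for u v
    proof -
      have "{u, v} \<in> edges_in C" using dart_inside_cycle[OF cycle uv] by simp
      then show ?thesis using iff uv by blast
    qed
    then show "inj_on (\<lambda>(u, v). {u, v}) ?X"
      by (auto simp: inj_on_def doubleton_eq_iff)
    show "(\<lambda>(u, v). {u, v}) ` ?X = edges_in C"
    proof
      show "edges_in C \<subseteq> (\<lambda>(u, v). {u, v}) ` ?X"
      proof
        fix e assume "e \<in> edges_in C"
        moreover from this obtain u v where "e = {u, v}" unfolding edges_of_def by blast
        ultimately show "e \<in> (\<lambda>(u, v). {u, v}) ` ?X"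
          using iff[of u v] by (auto simp: insert_commute image_iff)
      qed
    qed (use dart_inside_cycle[OF cycle] in auto)
  qed
  then show ?thesis using bij_betw_same_card card_edges_in[OF cycle] by metis
qed

lemma bij_betw_inside_cycles:
  "bij_betw (\<lambda>C. inside (edges_in C)) {C. induced_cycle C} (internal_faces V E \<sigma> Of)"
proof (rule bij_betw_imageI)
  show "inj_on (\<lambda>C. inside (edges_in C)) {C. induced_cycle C}"
  proof (rule inj_onI, unfold mem_Collect_eq)
    fix C C'
    assume cycle: "induced_cycle C" "induced_cycle C'" "inside (edges_in C) = inside (edges_in C')"
    have "edges_in C = boundary (inside (edges_in C))"
      by (rule boundary_inside[OF edges_in_even[OF cycle(1)], symmetric])
    also have "\<dots> = edges_in C'"
      unfolding cycle(3) by (rule boundary_inside[OF edges_in_even[OF cycle(2)]])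
    finally have "\<Union>(edges_in C) = \<Union>(edges_in C')" by (rule arg_cong)
    then show "C = C'" unfolding Union_edges_in[OF cycle(1)] Union_edges_in[OF cycle(2)] .
  qed
  have "\<exists>C. induced_cycle C \<and> inside (edges_in C) = f" if f_in: "f \<in> internal_faces V E \<sigma> Of" for f
  proof -
    have face: "f \<in> faces V E \<sigma>" using f_in unfolding internal_faces_def by blast
    then obtain d where d: "d \<in> f" using face_nonempty by blast
    then have "d \<in> D" using face_subset[OF face] by blast
    then obtain n where "walk (adj_in UNIV) (fst d) n (boundary f) (fst d)"
      using face_walk face_of_mem[OF face d] adj_in_UNIV by metis
    moreover have "d \<in> inside (boundary f)"
      using inside_boundary[OF region_internal_face[OF f_in]] d by simp
    moreover have "d \<in> inside Y \<or> d \<in> inside Z"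
      if "even_edge_set Y" "even_edge_set Z" "d \<in> inside (Y \<triangle> Z)" for Y Z
      using that(3) unfolding inside_sym_diff[OF that(1,2)] by blast
    ultimately obtain C where cycle: "induced_cycle C" "d \<in> inside (edges_in C)"
      using induced_cycle_of_closed_walk[where Q = "\<lambda>Z. d \<in> inside Z"] by (metis empty_iff inside_empty)
    then have "inside (edges_in C) = f"
      using inside_cycle_internal_face[OF cycle(1)] face_of_mem d face
      unfolding internal_faces_def by blast
    then show ?thesis using cycle(1) by blast
  qed
  then show "(\<lambda>C. inside (edges_in C)) ` {C. induced_cycle C} = internal_faces V E \<sigma> Of"
    using inside_cycle_internal_face by auto
qed

lemma ex_internal_face_iff:
  "(\<exists>f\<in>internal_faces V E \<sigma> Of. P (card f)) \<longleftrightarrow> (\<exists>C. induced_cycle C \<and> P (card C))"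
  unfolding bij_betw_imp_surj_on[OF bij_betw_inside_cycles, symmetric] by (auto simp: card_inside_cycle)

lemma card_internal_faces_eq:
  "card {f \<in> internal_faces V E \<sigma> Of. P (card f)} = card {C. induced_cycle C \<and> P (card C)}"
proof -
  have "bij_betw (\<lambda>C. inside (edges_in C)) {C \<in> {C. induced_cycle C}. P (card C)}
      {f \<in> internal_faces V E \<sigma> Of. P (card f)}"
    by (rule bij_betw_Collect[OF bij_betw_inside_cycles]) (simp add: card_inside_cycle)
  then show ?thesis using bij_betw_same_card by fastforce
qed

section \<open>Attachments to induced cycles\<close>

lemma dart_from_cycle_vertex:
  assumes cycle: "induced_cycle C" and v_in: "v \<in> C"
  shows "\<exists>w. (v, w) \<in> inside (edges_in C)"
proof -
  obtain p q where "{w\<in>C. E v w} = {p, q}" using induced_cycle_neighbours[OF cycle v_in] .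
  then have p: "E v p" "p \<in> C" by blast+
  then have "{v, p} \<in> boundary (inside (edges_in C))"
    using boundary_inside[OF edges_in_even[OF cycle]] v_in by simp
  then consider (out) "(v, p) \<in> inside (edges_in C)" | (into) "(p, v) \<in> inside (edges_in C)"
    unfolding boundary_iff by blast
  then show ?thesis
  proof cases
    case into
    moreover have "face_closed (inside (edges_in C))"
      using region_inside[OF edges_in_even[OF cycle]] unfolding region_def by blast
    ultimately show ?thesis using face_closed_rotation[OF _ p(1)] by blast
  qed blast
qed

text \<open>The inside of an induced cycle is a single face, which has a dart at every vertex of the cycle, and an
  even edge set encloses no dart at a vertex it misses.\<close>

lemma even_edge_set_spans_cycle:
  assumes cycle: "induced_cycle C"
  obtains d where "d \<in> inside (edges_in C)"
    "\<And>Z v. even_edge_set Z \<Longrightarrow> d \<in> inside Z \<Longrightarrow> v \<in> C \<Longrightarrow> \<exists>x. {v, x} \<in> Z"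
proof -
  have f: "inside (edges_in C) \<in> faces V E \<sigma>"
    using inside_cycle_internal_face[OF cycle] unfolding internal_faces_def by blast
  then obtain d where d: "d \<in> inside (edges_in C)" using face_nonempty by blast
  have "\<exists>x. {v, x} \<in> Z" if Z: "even_edge_set Z" "d \<in> inside Z" and v_in: "v \<in> C" for Z v
  proof -
    have "face d \<subseteq> inside Z"
      using face_closed_contains_face region_inside[OF Z(1)] Z(2) unfolding region_def by blast
    moreover obtain w where "(v, w) \<in> inside (edges_in C)"
      using dart_from_cycle_vertex[OF cycle v_in] by blast
    ultimately have "(v, w) \<in> inside Z" using face_of_mem[OF f d] by blast
    then show ?thesis by (rule dart_inside_incident[OF Z(1)])
  qed
  then show ?thesis by (rule that[OF d])
qed

lemma attachments_adjacent:
  assumes cycle: "induced_cycle C" and k_notin: "k \<notin> C"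
    and a_in: "a \<in> attachments C k" and b_in: "b \<in> attachments C k" and ab: "a \<noteq> b"
  shows "E a b"
proof -
  have C_ab: "a \<in> C" "b \<in> C" using a_in b_in attachments_subset by blast+
  obtain J where J: "J \<subseteq> edges" "odd_vertices J = {k, a}" "\<And>v w. v \<in> C \<Longrightarrow> v \<noteq> a \<Longrightarrow> {v, w} \<notin> J"
    using attachment_link[OF k_notin a_in] by blast
  obtain J' where J': "J' \<subseteq> edges" "odd_vertices J' = {k, b}" "\<And>v w. v \<in> C \<Longrightarrow> v \<noteq> b \<Longrightarrow> {v, w} \<notin> J'"
    using attachment_link[OF k_notin b_in] by blast
  have even: "even_edge_set (Y \<triangle> (J \<triangle> J'))" if "Y \<subseteq> edges_in C" "odd_vertices Y = {a, b}" for Y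
    using even_edge_set_link[OF _ J(1) J'(1) that(2) J(2) J'(2)]
      that(1) edges_in_subset_edges ab C_ab k_notin
    by blast
  obtain X where X: "X \<subseteq> edges_in C" "odd_vertices X = {a, b}"
    using path_edge_set[OF induced_cycle_connected[OF cycle C_ab]] ab by auto
  let ?X' = "edges_in C \<triangle> X"
  have X': "?X' \<subseteq> edges_in C" using X(1) by blast
  have "odd_vertices ?X' = odd_vertices (edges_in C) \<triangle> odd_vertices X"
    by (rule odd_vertices_sym_diff[OF finite_edges_in finite_subset[OF X(1) finite_edges_in]])
  then have oX': "odd_vertices ?X' = {a, b}"
    using X(2) edges_in_even[OF cycle] unfolding even_edge_set_def by simp
  obtain d where d: "d \<in> inside (edges_in C)"
    and spans: "\<And>Z v. even_edge_set Z \<Longrightarrow> d \<in> inside Z \<Longrightarrow> v \<in> C \<Longrightarrow> \<exists>x. {v, x} \<in> Z"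
    using even_edge_set_spans_cycle[OF cycle] by blast
  have "edges_in C = (X \<triangle> (J \<triangle> J')) \<triangle> (?X' \<triangle> (J \<triangle> J'))"
    unfolding set_eq_iff sym_diff_iff by blast
  then have "d \<in> inside (X \<triangle> (J \<triangle> J')) \<or> d \<in> inside (?X' \<triangle> (J \<triangle> J'))"
    using d inside_sym_diff[OF even[OF X] even[OF X' oX']] by auto
  then obtain Y where Y: "Y \<subseteq> edges_in C" "odd_vertices Y = {a, b}" "d \<in> inside (Y \<triangle> (J \<triangle> J'))"
    using X X' oX' by blast
  have "\<exists>x. {v, x} \<in> Y" if v_in: "v \<in> C - {a, b}" for v
  proof -
    obtain x where "{v, x} \<in> Y \<triangle> (J \<triangle> J')" using spans[OF even[OF Y(1,2)] Y(3)] v_in by blast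
    then show ?thesis using J(3)[of v x] J'(3)[of v x] v_in by blast
  qed
  then show ?thesis by (rule adjacent_if_arc_spans_cycle[OF cycle C_ab(1) Y(1,2)])
qed

lemma no_three_attachments:
  assumes cycle: "induced_cycle C" and k_notin: "k \<notin> C"
    and att: "a \<in> attachments C k" "b \<in> attachments C k" "c \<in> attachments C k"
  shows "a = b \<or> b = c \<or> a = c"
proof (rule ccontr)
  assume neg: "\<not> ?thesis"
  let ?A = "attachments C k"
  have adj: "E x y" if "x \<in> ?A" "y \<in> ?A" "x \<noteq> y" for x y
    using attachments_adjacent[OF cycle k_notin] that by blast
  have in_C: "x \<in> C" if "x \<in> ?A" for x using that attachments_subset by blast
  have "\<exists>J. J \<subseteq> edges \<and> odd_vertices J = {k, x} \<and> (\<forall>v\<in>C. v \<noteq> x \<longrightarrow> (\<forall>w. {v, w} \<notin> J))" if "x \<in> ?A" for x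
    using attachment_link[OF k_notin that] by metis
  then obtain J where J: "\<And>x. x \<in> ?A \<Longrightarrow> J x \<subseteq> edges" "\<And>x. x \<in> ?A \<Longrightarrow> odd_vertices (J x) = {k, x}"
    "\<And>x v w. x \<in> ?A \<Longrightarrow> v \<in> C \<Longrightarrow> v \<noteq> x \<Longrightarrow> {v, w} \<notin> J x"
    by metis
  define Y where "Y x y = {{x, y}} \<triangle> (J x \<triangle> J y)" for x y
  have even: "even_edge_set (Y x y)" if "x \<in> ?A" "y \<in> ?A" "x \<noteq> y" for x y
    unfolding Y_def
    by (rule even_edge_set_link[OF _ J(1)[OF that(1)] J(1)[OF that(2)]
          _ J(2)[OF that(1)] J(2)[OF that(2)]])
      (use that adj[OF that] in_C k_notin in \<open>auto simp: odd_vertices_edge\<close>)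
  obtain d where d: "d \<in> inside (edges_in C)"
    and spans: "\<And>Z v. even_edge_set Z \<Longrightarrow> d \<in> inside Z \<Longrightarrow> v \<in> C \<Longrightarrow> \<exists>x. {v, x} \<in> Z"
    using even_edge_set_spans_cycle[OF cycle] by blast
  have misses: "d \<notin> inside (Y x y)"
    if xyz: "x \<in> ?A" "y \<in> ?A" "z \<in> ?A" "x \<noteq> y" "z \<noteq> x" "z \<noteq> y" for x y z
  proof
    assume "d \<in> inside (Y x y)"
    then obtain w where "{z, w} \<in> Y x y"
      using spans[OF even[OF xyz(1,2,4)] _ in_C[OF xyz(3)]] by blast
    then show False
      using J(3)[OF xyz(1) in_C[OF xyz(3)] xyz(5)] J(3)[OF xyz(2) in_C[OF xyz(3)] xyz(6)] xyz(5,6)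
      unfolding Y_def by (auto simp: doubleton_eq_iff)
  qed
  have distinct: "a \<noteq> b" "b \<noteq> c" "a \<noteq> c" using neg by blast+
  have "edges_in C = {{a, b}, {b, c}, {a, c}}"
    by (rule edges_in_triangle[OF cycle]) (use in_C adj att distinct in blast)+
  also have "\<dots> = {{a, b}} \<triangle> {{b, c}} \<triangle> {{a, c}}"
    using distinct by (auto simp: doubleton_eq_iff)
  also have "\<dots> = Y a b \<triangle> Y b c \<triangle> Y a c"
    unfolding Y_def by (rule set_eqI, unfold sym_diff_iff) argo
  finally have "inside (edges_in C) = inside (Y a b \<triangle> Y b c \<triangle> Y a c)" by (rule arg_cong)
  also have "\<dots> = inside (Y a b) \<triangle> inside (Y b c) \<triangle> inside (Y a c)"
    by (simp only: inside_sym_diff even_edge_set_sym_diff even att distinct not_False_eq_True)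
  finally show False
    using d misses[of a b c] misses[of b c a] misses[of a c b] att distinct by blast
qed

lemma attachments_subset_edge:
  assumes cycle: "induced_cycle C" and k_notin: "k \<notin> C" and z_in: "z \<in> attachments C k"
  shows "\<exists>t\<in>C. E z t \<and> attachments C k \<subseteq> {z, t}"
proof (cases "attachments C k \<subseteq> {z}")
  case True
  have "z \<in> C" using z_in attachments_subset by blast
  then obtain p q where "{w\<in>C. E z w} = {p, q}" using induced_cycle_neighbours[OF cycle] by metis
  then show ?thesis using True by blast
next
  case False
  then obtain t where t: "t \<in> attachments C k" "t \<noteq> z" by blast
  then have "attachments C k \<subseteq> {z, t}" using no_three_attachments[OF cycle k_notin z_in t(1)] by blast
  then show ?thesis
    using t attachments_adjacent[OF cycle k_notin z_in] attachments_subset by blast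
qed

lemma induced_cycle_in_component:
  assumes cycle: "induced_cycle C" and cycle': "induced_cycle C'" and k_in: "k \<in> C'" "k \<notin> C"
  shows "C' \<subseteq> component C k \<union> attachments C k"
proof
  fix x assume x_in: "x \<in> C'"
  let ?A = "attachments C k"
  show "x \<in> component C k \<union> ?A"
  proof (cases "x \<in> ?A")
    case False
    have "k \<notin> ?A" using k_in(2) attachments_subset by blast
    have "(adj_in (C' - ?A))\<^sup>*\<^sup>* k x"
      by (rule induced_cycle_minus_clique_connected[OF cycle'])
        (use attachments_adjacent[OF cycle k_in(2)] x_in False k_in \<open>k \<notin> ?A\<close> in blast)+
    then have "x \<in> component C k"
    proof (induction rule: rtranclp_induct)
      case (step y z)
      then show ?case using component_step[OF k_in(2) step.IH, of z] unfolding adj_in_def by blast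
    qed (rule component_refl)
    then show ?thesis by blast
  qed blast
qed

end

section \<open>Cops and attacking robbers\<close>

definition pair_move :: "('a \<Rightarrow> 'a \<Rightarrow> bool) \<Rightarrow> 'a \<Rightarrow> 'a \<Rightarrow> 'a \<Rightarrow> 'a \<Rightarrow> bool" where
  "pair_move E u v u' v' \<longleftrightarrow> cmove E u u' \<and> cmove E v v' \<or> cmove E u v' \<and> cmove E v u'"

text \<open>In the following, \<open>c\<close> is a cop next to the robber at \<open>r\<close>. By passing, the robber would be captured by \<open>c\<close>,
  and by attacking \<open>c\<close>, he would be captured by the other cop \<open>c'\<close>; so he needs a vertex \<open>b\<close> to flee to.\<close>

definition refuge :: "('a \<Rightarrow> 'a \<Rightarrow> bool) \<Rightarrow> 'a set \<Rightarrow> bool" where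
  "refuge E S \<longleftrightarrow> (\<forall>r\<in>S. \<forall>c c'. c \<noteq> r \<longrightarrow> c' \<noteq> r \<longrightarrow> E c r \<longrightarrow> cmove E c' c \<longrightarrow>
    (\<exists>b\<in>S. E r b \<and> \<not> cmove E c b \<and> \<not> cmove E c' b))"

definition robber_safe :: "('a \<Rightarrow> 'a \<Rightarrow> bool) \<Rightarrow> 'a set \<Rightarrow> 'a multiset \<Rightarrow> 'a \<Rightarrow> bool" where
  "robber_safe E S M r \<longleftrightarrow> (\<forall>c\<in>#M. \<not> cmove E c r) \<and> (size M \<le> 1 \<or> size M = 2 \<and> r \<in> S)"

lemma cmove_refl [simp]: "cmove E x x"
  unfolding cmove_def by simp

lemma cmove_adj: "E x y \<Longrightarrow> cmove E x y"
  unfolding cmove_def by simp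

lemma cmove_sym: "symp E \<Longrightarrow> cmove E x y \<Longrightarrow> cmove E y x"
  unfolding cmove_def by (auto dest: sympD)

lemma pair_move_commute: "pair_move E u v u' v' \<longleftrightarrow> pair_move E u v v' u'"
  unfolding pair_move_def by blast

lemma rel_mset_pair_move:
  assumes "pair_move E u v u' v'"
  shows "rel_mset (cmove E) {#u, v#} {#u', v'#}"
proof -
  have "rel_mset (cmove E) {#u, v#} {#a, b#}" if "cmove E u a" "cmove E v b" for a b
    using that by (intro rel_mset_Plus rel_mset_Zero)
  from this[of u' v'] this[of v' u'] show ?thesis
    using assms unfolding pair_move_def by (auto simp: add_mset_commute)
qed

lemma rel_mset_memberD: "rel_mset R M N \<Longrightarrow> y \<in># N \<Longrightarrow> \<exists>x\<in>#M. R x y"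
  using rel_funD[OF multiset.set_transfer] by (metis rel_setD2)

lemma robber_safe_response:
  assumes sym: "symp E" and S: "refuge E S" and safe: "robber_safe E S M r"
    and move: "rel_mset (cmove E) M M'"
  shows "r \<notin># M'"
    and "\<exists>r'. cmove E r r' \<and> robber_safe E S (if r' \<in># M' then M' - {#r'#} else M') r'"
proof -
  have size: "size M' = size M" using rel_mset_size[OF move] by simp
  show r_notin: "r \<notin># M'"
    using safe rel_mset_memberD[OF move] unfolding robber_safe_def by blast
  consider (pass) "\<forall>c\<in>#M'. \<not> E c r"
    | (attack) c where "c \<in># M'" "E c r" "\<forall>c'\<in>#M' - {#c#}. \<not> cmove E c' c"
    | (flee) c c' where "c \<in># M'" "E c r" "c' \<in># M' - {#c#}" "cmove E c' c"
    by blast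
  then show "\<exists>r'. cmove E r r' \<and> robber_safe E S (if r' \<in># M' then M' - {#r'#} else M') r'"
  proof cases
    case pass
    then have "robber_safe E S M' r"
      using r_notin safe size unfolding robber_safe_def cmove_def by auto
    then show ?thesis using r_notin by (intro exI[of _ r]) simp
  next
    case attack
    then have "robber_safe E S (M' - {#c#}) c"
      using safe size unfolding robber_safe_def by (auto simp: size_Diff_singleton)
    then show ?thesis using attack sym by (intro exI[of _ c]) (auto simp: cmove_def dest: sympD)
  next
    case flee
    then obtain M'' where "M' = add_mset c (add_mset c' M'')" by (metis insert_DiffM)
    then have two: "M' = {#c, c'#}" "r \<in> S" using safe size unfolding robber_safe_def by auto
    moreover have "c \<noteq> r" "c' \<noteq> r" using r_notin two by auto
    ultimately obtain b where b: "b \<in> S" "E r b" "\<not> cmove E c b" "\<not> cmove E c' b"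
      using S flee unfolding refuge_def by blast
    then have "b \<notin># M'" using two by auto
    then show ?thesis
      using b two by (intro exI[of _ b]) (auto simp: cmove_def robber_safe_def)
  qed
qed

lemma robber_safe_not_cop_win:
  assumes "symp E" "refuge E S" "cop_win E M r"
  shows "\<not> robber_safe E S M r"
  using assms(3)
proof induction
  case (capture M M' r)
  then show ?case using robber_safe_response(1)[OF assms(1,2)] by blast
next
  case (step M M' r)
  then show ?case using robber_safe_response(2)[OF assms(1,2)] by blast
qed

lemma capture_single: "cmove E u r \<Longrightarrow> cop_win E {#u#} r"
  by (rule cop_win.capture[of E _ "{#r#}"]) (auto intro: rel_mset_Plus rel_mset_Zero)

lemma capture_pair:
  assumes "cmove E u r \<or> cmove E v r"
  shows "cop_win E {#u, v#} r"
proof -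
  have "pair_move E u v r v \<or> pair_move E u v r u" using assms unfolding pair_move_def by auto
  then obtain w where "pair_move E u v r w" by blast
  then show ?thesis by (intro cop_win.capture[OF rel_mset_pair_move]) auto
qed

text \<open>Cops on equal or adjacent vertices protect each other: an attacker is captured at once.\<close>

lemma protected_pair_move_wins:
  assumes sym: "symp E" and move: "pair_move E u v u' v'" and protected: "u' = v' \<or> E u' v'"
    and r_ne: "r \<noteq> u'" "r \<noteq> v'"
    and win: "\<And>r'. cmove E r r' \<Longrightarrow> r' \<noteq> u' \<Longrightarrow> r' \<noteq> v' \<Longrightarrow> cop_win E {#u', v'#} r'"
  shows "cop_win E {#u, v#} r"
proof (rule cop_win.step[OF rel_mset_pair_move[OF move]])
  have "cmove E u' v'" "cmove E v' u'"
    using protected sym by (auto simp: cmove_def dest: sympD)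
  then have "cop_win E ({#u', v'#} - {#r'#}) r'" if "r' = u' \<or> r' = v'" for r'
    using that capture_single by auto
  then show "\<forall>r'. cmove E r r' \<longrightarrow>
      cop_win E (if r' \<in># {#u', v'#} then {#u', v'#} - {#r'#} else {#u', v'#}) r'"
    using win by simp
qed (use r_ne in simp)

lemma not_cops_win_le_1:
  assumes graph: "graph V E" and "V \<noteq> {}" and no_universal: "\<not> (\<exists>v\<in>V. universal_vertex V E v)"
    and k: "k \<le> 1"
  shows "\<not> cops_win V E k"
proof
  assume "cops_win V E k"
  then obtain M where M: "size M = k" "set_mset M \<subseteq> V" and win: "\<And>r. r \<in> V \<Longrightarrow> cop_win E M r"
    unfolding cops_win_def by blast
  consider (none) "M = {#}" | (one) x where "M = {#x#}"
    using M(1) k by (metis One_nat_def le_SucE le_zero_eq size_1_singleton_mset size_eq_0_iff_empty)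
  then have "\<exists>r\<in>V. \<forall>c\<in>#M. \<not> cmove E c r"
  proof cases
    case none
    then show ?thesis using \<open>V \<noteq> {}\<close> by auto
  next
    case one
    then show ?thesis using no_universal M(2) unfolding universal_vertex_def cmove_def by auto
  qed
  then obtain r where r: "r \<in> V" "robber_safe E {} M r"
    using M(1) k unfolding robber_safe_def by blast
  have "symp E" "refuge E {}"
    using graph unfolding graph_def symp_def refuge_def by blast+
  then show False using robber_safe_not_cop_win win[OF r(1)] r(2) by metis
qed

lemma cops_win_card:
  assumes "finite V"
  shows "cops_win V E (card V)"
proof -
  have "cop_win E (mset_set V) r" if "r \<in> V" for r
    using that assms by (intro cop_win.capture[of E _ "mset_set V"] multiset.rel_refl) simp_all
  then show ?thesis
    using assms unfolding cops_win_def by (intro exI[of _ "mset_set V"]) auto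
qed

lemma attacking_cop_number_eq_2_iff:
  assumes "graph V E" "V \<noteq> {}" "\<not> (\<exists>v\<in>V. universal_vertex V E v)"
  shows "attacking_cop_number V E = 2 \<longleftrightarrow> cops_win V E 2"
proof
  have wins: "cops_win V E (attacking_cop_number V E)"
    using cops_win_card assms(1) unfolding attacking_cop_number_def graph_def by (metis LeastI)
  then show "attacking_cop_number V E = 2 \<Longrightarrow> cops_win V E 2" by simp
  assume "cops_win V E 2"
  then have "attacking_cop_number V E \<le> 2" unfolding attacking_cop_number_def by (rule Least_le)
  moreover have "\<not> attacking_cop_number V E \<le> 1" using not_cops_win_le_1[OF assms] wins by blast
  ultimately show "attacking_cop_number V E = 2" by linarith
qed

section \<open>A winning strategy for two cops\<close>

context simple_graph
begin

definition guarded :: "'a \<Rightarrow> 'a \<Rightarrow> 'a set \<Rightarrow> bool" where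
  "guarded u v K \<longleftrightarrow> K \<subseteq> V \<and> u \<in> V - K \<and> v \<in> V - K \<and> (u = v \<or> E u v) \<and>
    (\<forall>x\<in>K. \<forall>y. E x y \<longrightarrow> y \<in> K \<union> {u, v})"

definition short_cycles :: "'a set \<Rightarrow> bool" where
  "short_cycles W \<longleftrightarrow> (\<forall>C. induced_cycle C \<longrightarrow> C \<subseteq> W \<longrightarrow> card C \<le> 4)"

text \<open>Moving both cops onto one vertex counts as progress even if the territory does not shrink.\<close>

definition effort :: "'a \<Rightarrow> 'a \<Rightarrow> 'a set \<Rightarrow> nat" where
  "effort u v K = 2 * card K + (if u = v then 0 else 1)"

definition progress :: "'a \<Rightarrow> 'a \<Rightarrow> 'a set \<Rightarrow> 'a \<Rightarrow> bool" where
  "progress u v K r \<longleftrightarrow> (\<exists>u' v' K'. pair_move E u v u' v' \<and> guarded u' v' K' \<and> r \<in> K' \<and>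
    K' \<union> {u', v'} \<subseteq> K \<union> {u, v} \<and> effort u' v' K' < effort u v K)"

lemma guarded_commute: "guarded u v K \<longleftrightarrow> guarded v u K"
  unfolding guarded_def using adj_sym by (auto simp: insert_commute)

lemma guarded_finite: "guarded u v K \<Longrightarrow> finite K"
  unfolding guarded_def using finite_vertices finite_subset by blast

lemma guarded_cmove: "guarded u v K \<Longrightarrow> x \<in> K \<Longrightarrow> cmove E x y \<Longrightarrow> y \<in> K \<union> {u, v}"
  unfolding guarded_def cmove_def by blast

lemma guarded_component:
  assumes "guarded u v K" "r \<in> K"
  shows "component {u, v} r \<subseteq> K" "guarded u v (component {u, v} r)"
proof -
  have r_notin: "r \<notin> {u, v}" using assms unfolding guarded_def by blast
  show sub: "component {u, v} r \<subseteq> K"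
    using assms unfolding guarded_def by (intro component_least) blast+
  show "guarded u v (component {u, v} r)"
    using assms(1) sub component_step[OF r_notin] attachments_subset[of "{u, v}" r]
    unfolding guarded_def by blast
qed

lemma progress_commute: "progress u v K r \<longleftrightarrow> progress v u K r"
proof -
  have "pair_move E u v u' v' \<longleftrightarrow> pair_move E v u u' v'" for u' v'
    unfolding pair_move_def by blast
  moreover have "effort u v K = effort v u K" unfolding effort_def by auto
  ultimately show ?thesis unfolding progress_def by (simp add: insert_commute)
qed

lemma progress_mono: "progress u v K r \<Longrightarrow> finite K' \<Longrightarrow> K \<subseteq> K' \<Longrightarrow> progress u v K' r"
proof -
  assume K: "finite K'" "K \<subseteq> K'"
  then have "effort u v K \<le> effort u v K'" unfolding effort_def by (simp add: card_mono)
  then show "progress u v K r \<Longrightarrow> progress u v K' r"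
    using K(2) unfolding progress_def by (meson Un_mono order_less_le_trans order_refl order_trans)
qed

lemma progress_one_sided:
  assumes guarded: "guarded u v K" and "u \<noteq> v" "r \<in> K" and unattached: "\<And>x. x \<in> K \<Longrightarrow> \<not> E x v"
  shows "progress u v K r"
proof -
  have "guarded u u K" using guarded unattached unfolding guarded_def by blast
  moreover have "pair_move E u v u u"
    using guarded \<open>u \<noteq> v\<close> adj_sym unfolding pair_move_def guarded_def cmove_def by blast
  moreover have "effort u u K < effort u v K"
    using \<open>u \<noteq> v\<close> unfolding effort_def by simp
  ultimately show ?thesis
    using \<open>r \<in> K\<close> unfolding progress_def by blast
qed

lemma guarded_outside_cycle:
  assumes cycle: "induced_cycle C" and r_in: "r \<in> V" "r \<notin> C"
    and st: "s \<in> C" "t \<in> C" "E s t" "attachments C r \<subseteq> {s, t}"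
  shows "guarded s t (component C r)"
  using component_subset_vertices[OF r_in(1)] component_disjoint[OF r_in(2)] component_step[OF r_in(2)]
    induced_cycle_subset_vertices[OF cycle] st unfolding guarded_def by blast

lemma induced_cycle_through_edge:
  assumes uv: "E u v" and r_notin: "r \<notin> {u, v}"
    and a_in: "a \<in> component {u, v} r" "E a u" and b_in: "b \<in> component {u, v} r" "E b v"
  shows "\<exists>C. induced_cycle C \<and> {u, v} \<subseteq> C \<and> C \<subseteq> component {u, v} r \<union> {u, v}"
proof -
  let ?K = "component {u, v} r"
  let ?W = "?K \<union> {u, v}"
  have K: "u \<notin> ?K" "v \<notin> ?K" using component_disjoint[OF r_notin] by blast+
  obtain n P where P: "walk (adj_in ?K) a n P b"
    using walk_of_rtranclp[OF component_connected[OF a_in(1) b_in(1)]] by blast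
  have walk_ab: "walk (adj_in ?W) a n P b"
    by (rule walk_mono[OF P]) (auto simp: adj_in_def)
  have "adj_in ?W u a" "adj_in ?W b v" "adj_in ?W v u"
    using uv a_in b_in adj_sym unfolding adj_in_def by auto
  then have steps: "walk (adj_in ?W) u (Suc 0) {{u, a}} a" "walk (adj_in ?W) b (Suc 0) {{b, v}} v"
    "walk (adj_in ?W) v (Suc 0) {{v, u}} u"
    by (simp_all add: walk_edge)
  have walk: "walk (adj_in ?W) u (Suc 0 + n + Suc 0 + Suc 0) ({{u, a}} \<triangle> P \<triangle> {{b, v}} \<triangle> {{v, u}}) u"
    by (rule walk_append[OF walk_append[OF walk_append[OF steps(1) walk_ab] steps(2)] steps(3)])
  have "{u, v} \<notin> P" using walk_subset_edges[OF P] K by auto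
  then have "{u, v} \<in> {{u, a}} \<triangle> P \<triangle> {{b, v}} \<triangle> {{v, u}}"
    using a_in b_in K adj_irrefl by (auto simp: doubleton_eq_iff)
  then obtain C where "induced_cycle C" "C \<subseteq> ?W" "{u, v} \<in> edges_in C"
    using induced_cycle_of_closed_walk[OF walk, of "\<lambda>Z. {u, v} \<in> Z"] by auto
  then show ?thesis by auto
qed

lemma induced_cycle_attachment_beyond_edge:
  assumes cycle: "induced_cycle C" and sub: "C \<subseteq> component {u, v} r \<union> {u, v}" and r_notin: "r \<notin> C"
  obtains z where "z \<in> attachments C r" "z \<noteq> u" "z \<noteq> v"
proof -
  have "\<not> attachments C r \<subseteq> {u, v}"
  proof
    assume "attachments C r \<subseteq> {u, v}"
    then have "component {u, v} r \<subseteq> component C r"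
      using component_step[OF r_notin] component_refl by (intro component_least) blast+
    then have "C \<subseteq> {u, v}" using sub component_disjoint[OF r_notin] by blast
    then have "card C \<le> card {u, v}" by (intro card_mono) auto
    also have "\<dots> \<le> 2" by (simp add: card_insert_if)
    finally show False using induced_cycle_card_ge[OF cycle] by simp
  qed
  then show ?thesis using that by blast
qed

lemma edge_dominates_short_cycle:
  assumes cycle: "induced_cycle C" "card C \<le> 4" and uv: "u \<in> C" "v \<in> C" "E u v" and w_in: "w \<in> C"
  shows "cmove E u w \<or> cmove E v w"
proof -
  obtain a where a: "{x\<in>C. E u x} = {v, a}" "a \<noteq> v"
    using induced_cycle_other_neighbour[OF cycle(1) uv] .
  obtain b where b: "{x\<in>C. E v x} = {u, b}" "b \<noteq> u"
    using induced_cycle_other_neighbour[OF cycle(1) uv(2,1) adj_sym[OF uv(3)]] .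
  have adj: "a \<in> C" "E u a" "b \<in> C" "E v b" using a(1) b(1) by blast+
  have "C = {u, v, a, b}"
  proof (cases "a = b")
    case True
    then show ?thesis
      using induced_cycle_triangle[OF cycle(1) uv(1,2) adj(1) uv(3)] adj by auto
  next
    case False
    moreover have "u \<noteq> v" "u \<noteq> a" "v \<noteq> b" using uv(3) adj adj_irrefl by blast+
    ultimately have "card {u, v, a, b} = 4" using a(2) b(2) by simp
    then show ?thesis
      using card_seteq[OF induced_cycle_finite[OF cycle(1)], of "{u, v, a, b}"] cycle(2) uv adj by auto
  qed
  then show ?thesis using w_in adj unfolding cmove_def by auto
qed

lemma short_cycle_pair_move:
  assumes cycle: "induced_cycle C" "card C \<le> 4"
    and uv: "u \<in> C" "v \<in> C" "E u v" and zt: "z \<in> C" "t \<in> C" "E z t"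
  shows "pair_move E u v z t"
proof (rule ccontr)
  assume neg: "\<not> pair_move E u v z t"
  have crowded: "cmove E y z \<or> cmove E y t"
    if "x \<in> C" "y \<in> C" "E x y" "cmove E x z" "cmove E x t" for x y
  proof (rule ccontr)
    assume far: "\<not> ?thesis"
    then have "x \<noteq> z" "x \<noteq> t" "y \<noteq> z" "y \<noteq> t"
      using adj_sym[OF that(3)] unfolding cmove_def by blast+
    moreover have "z \<noteq> t" using zt(3) adj_irrefl by blast
    ultimately show False
      using induced_cycle_neighbours_eq[OF cycle(1), of x z t] that zt unfolding cmove_def by blast
  qed
  have "cmove E u z \<or> cmove E v z" "cmove E u t \<or> cmove E v t"
    using edge_dominates_short_cycle[OF cycle uv] zt by blast+
  then show False
    using neg crowded[OF uv] crowded[OF uv(2,1) adj_sym[OF uv(3)]] unfolding pair_move_def by blast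
qed

end

context outerplane_graph
begin

lemma progress_joined_cops:
  assumes guarded: "guarded u u (component {u} r)" and far: "\<not> cmove E u r"
  shows "progress u u (component {u} r) r"
proof -
  let ?K = "component {u} r"
  have r_notin: "r \<notin> {u}" "r \<in> V" using far guarded component_refl unfolding guarded_def by auto
  have "E\<^sup>*\<^sup>* r u" using reachable r_notin(2) guarded unfolding guarded_def by blast
  then have "\<exists>x\<in>?K. E x u"
  proof (rule contrapos_pp)
    assume no: "\<not> (\<exists>x\<in>?K. E x u)"
    have "y \<in> ?K" if "E\<^sup>*\<^sup>* r y" for y
      using that
    proof (induction rule: rtranclp_induct)
      case (step y z)
      then show ?case using component_step[OF r_notin(1) step.IH, of z] attachments_subset[of "{u}" r]
          no by blast
    qed (rule component_refl)
    then show "\<not> E\<^sup>*\<^sup>* r u" using guarded unfolding guarded_def by blast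
  qed
  then obtain x where x: "x \<in> ?K" "E x u" by blast
  have "guarded u x (?K - {x})"
    using guarded x adj_sym unfolding guarded_def by blast
  moreover have "r \<in> ?K - {x}"
    using component_refl far adj_sym[OF x(2)] by (auto simp: cmove_def)
  moreover have "pair_move E u u u x"
    using adj_sym[OF x(2)] unfolding pair_move_def cmove_def by blast
  moreover have "effort u x (?K - {x}) < effort u u ?K"
    using x(1) card_Diff1_less[OF guarded_finite[OF guarded] x(1)] unfolding effort_def by auto
  ultimately show ?thesis using x(1) unfolding progress_def by blast
qed

lemma progress_short_cycle:
  assumes guarded: "guarded u v (component {u, v} r)" and "u \<noteq> v"
    and short: "short_cycles (component {u, v} r \<union> {u, v})"
    and far: "\<not> cmove E u r" "\<not> cmove E v r"
    and att: "a \<in> component {u, v} r" "E a u" "b \<in> component {u, v} r" "E b v"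
  shows "progress u v (component {u, v} r) r"
proof -
  let ?K = "component {u, v} r"
  have r_notin: "r \<notin> {u, v}" using far by auto
  have uv: "E u v" using guarded \<open>u \<noteq> v\<close> unfolding guarded_def by blast
  obtain C where cycle: "induced_cycle C" "u \<in> C" "v \<in> C" "C \<subseteq> ?K \<union> {u, v}"
    using induced_cycle_through_edge[OF uv r_notin att] by blast
  then have card: "card C \<le> 4" using short unfolding short_cycles_def by blast
  have rC: "r \<notin> C"
    using edge_dominates_short_cycle[OF cycle(1) card cycle(2,3) uv] far by blast
  have rV: "r \<in> V" using guarded component_refl unfolding guarded_def by blast
  have sub: "component C r \<subseteq> ?K"
    using component_step[OF r_notin] attachments_subset[of "{u, v}" r] cycle(2,3) component_refl
    by (intro component_least) blast+
  obtain z where z: "z \<in> attachments C r" "z \<noteq> u" "z \<noteq> v"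
    using induced_cycle_attachment_beyond_edge[OF cycle(1,4) rC] .
  then obtain t where t: "t \<in> C" "E z t" "attachments C r \<subseteq> {z, t}"
    using attachments_subset_edge[OF cycle(1) rC] by blast
  have zC: "z \<in> C" using z(1) attachments_subset by blast
  have "guarded z t (component C r)"
    by (rule guarded_outside_cycle[OF cycle(1) rV rC zC t])
  moreover have "pair_move E u v z t"
    by (rule short_cycle_pair_move[OF cycle(1) card cycle(2,3) uv zC t(1,2)])
  moreover have "component C r \<subset> ?K"
    using sub zC z cycle(4) component_disjoint[OF rC] by blast
  then have "card (component C r) < card ?K" by (rule psubset_card_mono[OF guarded_finite[OF guarded]])
  then have "effort z t (component C r) < effort u v ?K"
    using \<open>u \<noteq> v\<close> unfolding effort_def by simp
  moreover have "component C r \<union> {z, t} \<subseteq> ?K \<union> {u, v}"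
    using sub cycle(4) zC t(1) by blast
  ultimately show ?thesis using component_refl unfolding progress_def by blast
qed

lemma guarded_progress:
  assumes guarded: "guarded u v K" and r_in: "r \<in> K" and short: "short_cycles (K \<union> {u, v})"
    and far: "\<not> cmove E u r" "\<not> cmove E v r"
  shows "progress u v K r"
proof (rule progress_mono[OF _ guarded_finite[OF guarded] guarded_component(1)[OF guarded r_in]])
  let ?K = "component {u, v} r"
  note guarded' = guarded_component(2)[OF guarded r_in] and refl = component_refl[of r "{u, v}"]
  have short': "short_cycles (?K \<union> {u, v})"
    using short guarded_component(1)[OF guarded r_in] unfolding short_cycles_def by blast
  consider (joined) "u = v" | (u_free) "u \<noteq> v" "\<forall>x\<in>?K. \<not> E x u"
    | (v_free) "u \<noteq> v" "\<forall>x\<in>?K. \<not> E x v"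
    | (attached) a b where "u \<noteq> v" "a \<in> ?K" "E a u" "b \<in> ?K" "E b v" by blast
  then show "progress u v ?K r"
  proof cases
    case joined
    then show ?thesis using progress_joined_cops[of v r] guarded' far by simp
  next
    case u_free
    then have "progress v u ?K r"
      using progress_one_sided[of v u] guarded_commute guarded' refl by blast
    then show ?thesis by (simp only: progress_commute)
  next
    case v_free
    then show ?thesis using progress_one_sided[OF guarded'] refl by blast
  next
    case attached
    then show ?thesis using progress_short_cycle[OF guarded' _ short' far] by blast
  qed
qed

lemma guarded_cop_win:
  assumes "guarded u v K" "short_cycles (K \<union> {u, v})" "r \<in> K"
  shows "cop_win E {#u, v#} r"
  using assms
proof (induction "effort u v K" arbitrary: u v K r rule: less_induct)
  case less
  show ?case
  proof (cases "cmove E u r \<or> cmove E v r")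
    case True
    then show ?thesis by (rule capture_pair)
  next
    case False
    then obtain u' v' K' where move: "pair_move E u v u' v'" and guarded': "guarded u' v' K'"
      and r_in: "r \<in> K'"
      and sub: "K' \<union> {u', v'} \<subseteq> K \<union> {u, v}" and smaller: "effort u' v' K' < effort u v K"
      using guarded_progress[OF less.prems(1,3,2)] unfolding progress_def by blast
    have short: "short_cycles (K' \<union> {u', v'})"
      using less.prems(2) sub unfolding short_cycles_def by blast
    show ?thesis
    proof (rule protected_pair_move_wins[OF symp_adj move])
      show "u' = v' \<or> E u' v'" "r \<noteq> u'" "r \<noteq> v'" using guarded' r_in unfolding guarded_def by blast+
      show "cop_win E {#u', v'#} r'" if "cmove E r r'" "r' \<noteq> u'" "r' \<noteq> v'" for r'
        using less.hyps[OF smaller guarded' short] guarded_cmove[OF guarded' r_in that(1)]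
          that(2,3) by blast
    qed
  qed
qed

lemma attachments_subset_cycle_enum_edge:
  assumes enum: "cycle_enum c n" and k_notin: "k \<notin> range c"
  shows "\<exists>i. 0 \<le> i \<and> i < int n \<and> attachments (range c) k \<subseteq> {c i, c (i + 1)}"
proof -
  have cycle: "induced_cycle (range c)" using enum unfolding induced_cycle_def by blast
  have "\<exists>i. attachments (range c) k \<subseteq> {c i, c (i + 1)}"
  proof (cases "attachments (range c) k = {}")
    case False
    then obtain z where z: "z \<in> attachments (range c) k" by blast
    then obtain t where t: "t \<in> range c" "E z t" "attachments (range c) k \<subseteq> {z, t}"
      using attachments_subset_edge[OF cycle k_notin] by blast
    obtain i where i: "z = c i" using z attachments_subset by blast
    then have "t = c (i - 1) \<or> t = c (i + 1)" using cycle_enum_neighbours(1)[OF enum, of i] t by blast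
    then show ?thesis
    proof
      assume "t = c (i - 1)"
      then show ?thesis using t(3) i by (intro exI[of _ "i - 1"]) (simp add: insert_commute)
    qed (use t(3) i in blast)
  qed blast
  then obtain i where "attachments (range c) k \<subseteq> {c i, c (i + 1)}" ..
  moreover have "c i = c (i mod int n)" "c (i + 1) = c (i mod int n + 1)"
    using enum unfolding cycle_enum_def by (simp_all add: cong_def mod_add_left_eq)
  moreover have "0 \<le> i mod int n" "i mod int n < int n"
    using enum unfolding cycle_enum_def by simp_all
  ultimately show ?thesis by metis
qed

lemma cops_win_beside_attachments:
  assumes cycle: "induced_cycle S" and r_in: "r \<in> V" "r \<notin> S"
    and short: "short_cycles (component S r \<union> {s, t})"
    and st: "s \<in> S" "t \<in> S" "E s t" "attachments S r \<subseteq> {s, t}" and w_in: "w \<in> S" "E s w"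
    and move: "pair_move E p q s w"
  shows "cop_win E {#p, q#} r"
proof (rule protected_pair_move_wins[OF symp_adj move])
  note guarded = guarded_outside_cycle[OF cycle r_in st] and win = guarded_cop_win[OF _ short]
  have disjoint: "x \<notin> S" if "x \<in> component S r" for x
    using component_disjoint[OF r_in(2)] that by blast
  show "s = w \<or> E s w" "r \<noteq> s" "r \<noteq> w" using w_in r_in(2) st(1) by auto
  fix r' assume r': "cmove E r r'" "r' \<noteq> s" "r' \<noteq> w"
  then consider (at_t) "r' = t" | (in_component) "r' \<in> component S r"
    using guarded_cmove[OF guarded component_refl] by blast
  then show "cop_win E {#s, w#} r'"
  proof cases
    case at_t
    then show ?thesis using st(3) cmove_adj[of E] by (intro capture_pair) blast
  next
    case in_component
    show ?thesis
    proof (rule protected_pair_move_wins[OF symp_adj])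
      show "pair_move E s w s t"
        using st(3) w_in(2) adj_sym unfolding pair_move_def cmove_def by blast
      show "s = t \<or> E s t" "r' \<noteq> s" "r' \<noteq> t" using st disjoint[OF in_component] by auto
      show "cop_win E {#s, t#} x" if "cmove E r' x" "x \<noteq> s" "x \<noteq> t" for x
        using win[OF guarded] guarded_cmove[OF guarded in_component that(1)] that(2,3) by blast
    qed
  qed
qed

lemma cops_win_formation:
  assumes enum: "cycle_enum c n" and r_in: "r \<in> V" "r \<notin> range c"
    and short: "\<And>s t. s \<in> range c \<Longrightarrow> t \<in> range c \<Longrightarrow> short_cycles (component (range c) r \<union> {s, t})"
    and move: "pair_move E p q (c j) (c (j + 1))"
    and i: "j - 1 \<le> i" "i \<le> j + 1" and att: "attachments (range c) r \<subseteq> {c i, c (i + 1)}"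
  shows "cop_win E {#p, q#} r"
proof -
  have cycle: "induced_cycle (range c)" using enum unfolding induced_cycle_def by blast
  note adj = cycle_enum_adj[OF enum] adj_sym[OF cycle_enum_adj[OF enum]]
  note beside = cops_win_beside_attachments[OF cycle r_in short]
  consider (before) "i = j - 1" | (on) "i = j" | (after) "i = j + 1" using i by linarith
  then show ?thesis
  proof cases
    case before
    then show ?thesis
      using att adj[of i] adj[of j] move by (intro beside[of "c j" "c i" "c (j + 1)"]) auto
  next
    case on
    then show ?thesis
      using att adj[of j] move by (intro beside[of "c j" "c (j + 1)" "c (j + 1)"]) auto
  next
    case after
    have "pair_move E p q (c (j + 1)) (c j)" using move pair_move_commute by metis
    then show ?thesis
      using after att adj[of i] adj[of j]
      by (intro beside[of "c (j + 1)" "c (i + 1)" "c j"]) auto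
  qed
qed

lemma distance_three_cops_dominate:
  assumes enum: "cycle_enum c n" and n_in: "n \<in> {5, 6}" and r_in: "r \<in> range c"
  shows "cmove E (c 0) r \<or> cmove E (c 3) r"
proof -
  obtain i where i: "0 \<le> i" "i < int n" "c i = r" using cycle_enum_index[OF enum r_in] .
  then have "i \<in> {0, 1, 2, 3, 4, 5}" "i = 5 \<Longrightarrow> n = 6" using n_in by auto
  moreover have
    "cmove E (c j) (c i) \<longleftrightarrow> [j = i] (mod int n) \<or> [i = j + 1] (mod int n) \<or> [j = i + 1] (mod int n)" for j
    using enum unfolding cmove_def cycle_enum_def by blast
  ultimately show ?thesis
    unfolding i(3)[symmetric] using n_in by (auto simp: cong_def)
qed

lemma short_cycles_beside_only_long_cycle:
  assumes S: "5 \<le> card S" and unique: "\<And>C. induced_cycle C \<Longrightarrow> 5 \<le> card C \<Longrightarrow> C = S"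
    and r_notin: "r \<notin> S"
  shows "short_cycles (component S r \<union> {s, t})"
  unfolding short_cycles_def
proof (intro allI impI)
  fix C assume cycle: "induced_cycle C" "C \<subseteq> component S r \<union> {s, t}"
  show "card C \<le> 4"
  proof (rule ccontr)
    assume "\<not> card C \<le> 4"
    then have "C = S" using unique cycle(1) by simp
    then have "S \<subseteq> {s, t}" using cycle(2) component_disjoint[OF r_notin] by blast
    then have "card S \<le> card {s, t}" by (intro card_mono) auto
    also have "\<dots> \<le> 2" by (simp add: card_insert_if)
    finally show False using S by simp
  qed
qed

lemma cops_win_one_long_cycle:
  assumes cycle: "induced_cycle S" "card S \<in> {5, 6}"
    and unique: "\<And>C. induced_cycle C \<Longrightarrow> 5 \<le> card C \<Longrightarrow> C = S"
  shows "cops_win V E 2"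
proof -
  obtain c where enum: "cycle_enum c (card S)" "range c = S" using induced_cycle_enum[OF cycle(1)] .
  have adj: "E (c i) (c j) \<longleftrightarrow> [j = i + 1] (mod int (card S)) \<or> [i = j + 1] (mod int (card S))"
    and eq: "c i = c j \<longleftrightarrow> [i = j] (mod int (card S))" for i j
    using enum(1) unfolding cycle_enum_def by blast+
  have "cop_win E {#c 0, c 3#} r" if r_in: "r \<in> V" for r
  proof (cases "r \<in> S")
    case True
    then show ?thesis
      using distance_three_cops_dominate[OF enum(1) cycle(2)] enum(2) by (intro capture_pair) blast
  next
    case False
    have "5 \<le> card S" using cycle(2) by auto
    note short = short_cycles_beside_only_long_cycle[OF this unique False]
    obtain i where i: "0 \<le> i" "i < int (card S)" "attachments S r \<subseteq> {c i, c (i + 1)}"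
      using attachments_subset_cycle_enum_edge[OF enum(1), of r] False enum(2) by auto
    note formation = cops_win_formation[OF enum(1), unfolded enum(2), OF r_in False short _ _ _ i(3)]
    show ?thesis
    proof (cases "i \<le> 2")
      case True
      have "pair_move E (c 0) (c 3) (c 1) (c (1 + 1))"
        unfolding pair_move_def cmove_def adj by (simp add: cong_def)
      then show ?thesis using formation i(1) True by fastforce
    next
      case False
      have "pair_move E (c 0) (c 3) (c 4) (c (4 + 1))"
        unfolding pair_move_def cmove_def adj eq using cycle(2) by (auto simp: cong_def)
      then show ?thesis using formation i(2) False cycle(2) by fastforce
    qed
  qed
  then show ?thesis
    unfolding cops_win_def using induced_cycle_subset_vertices[OF cycle(1)] enum(2)
    by (intro exI[of _ "{#c 0, c 3#}"]) auto
qed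

lemma cops_win_short_cycles:
  assumes "short_cycles V"
  shows "cops_win V E 2"
proof -
  obtain u where u: "u \<in> V" using vertices_nonempty by blast
  have "V - {u} \<union> {u, u} = V" using u by blast
  moreover have "guarded u u (V - {u})" using u adj_vertices unfolding guarded_def by blast
  ultimately have "cop_win E {#u, u#} r" if "r \<in> V - {u}" for r
    using guarded_cop_win that assms by metis
  moreover have "cop_win E {#u, u#} u" by (rule capture_pair) simp
  ultimately have "cop_win E {#u, u#} r" if "r \<in> V" for r using that by blast
  then show ?thesis
    unfolding cops_win_def using u by (intro exI[of _ "{#u, u#}"]) auto
qed

lemma cops_win_few_long_cycles:
  assumes "\<And>C. induced_cycle C \<Longrightarrow> card C \<le> 6"
    and unique: "\<And>C C'. induced_cycle C \<Longrightarrow> induced_cycle C' \<Longrightarrow> 5 \<le> card C \<Longrightarrow> 5 \<le> card C' \<Longrightarrow> C = C'"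
  shows "cops_win V E 2"
proof (cases "\<exists>S. induced_cycle S \<and> 5 \<le> card S")
  case True
  then obtain S where cycle: "induced_cycle S" "5 \<le> card S" by blast
  then have "card S \<in> {5, 6}" using assms(1)[OF cycle(1)] by auto
  then show ?thesis by (rule cops_win_one_long_cycle[OF cycle(1) _ unique[OF _ cycle(1) _ cycle(2)]])
next
  case False
  then have "short_cycles V" unfolding short_cycles_def by force
  then show ?thesis by (rule cops_win_short_cycles)
qed

end

section \<open>Evading two cops\<close>

context outerplane_graph
begin

definition closed_nbhd :: "'a \<Rightarrow> 'a set" where
  "closed_nbhd z = {w. cmove E z w}"

lemma closed_nbhd_refl: "z \<in> closed_nbhd z"
  unfolding closed_nbhd_def by simp

lemma closed_nbhd_inter_cycle:
  assumes "induced_cycle C" "z \<in> C"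
  shows "closed_nbhd z \<inter> C = insert z {w\<in>C. E z w}"
  using assms(2) unfolding closed_nbhd_def cmove_def by blast

lemma closed_nbhd_inter_subset_attachments: "z \<notin> C \<Longrightarrow> closed_nbhd z \<inter> C \<subseteq> attachments C z"
  using component_refl unfolding closed_nbhd_def cmove_def attachments_def by blast

lemma card_attachments_le:
  assumes "induced_cycle C" "k \<notin> C"
  shows "card (attachments C k) \<le> 2"
proof (cases "attachments C k = {}")
  case False
  then obtain z t where "attachments C k \<subseteq> {z, t}" using attachments_subset_edge[OF assms] by blast
  then have "card (attachments C k) \<le> card {z, t}" by (intro card_mono) auto
  also have "\<dots> \<le> 2" by (simp add: card_insert_if)
  finally show ?thesis .
qed simp

lemma card_closed_nbhd_inter_cycle:
  assumes cycle: "induced_cycle C"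
  shows "z \<notin> C \<Longrightarrow> card (closed_nbhd z \<inter> C) \<le> 2" and "card (closed_nbhd z \<inter> C) \<le> 3"
proof -
  show outside: "card (closed_nbhd z \<inter> C) \<le> 2" if "z \<notin> C"
    using card_mono[OF _ closed_nbhd_inter_subset_attachments[OF that]] card_attachments_le[OF cycle that]
      finite_subset[OF attachments_subset induced_cycle_finite[OF cycle]] by (meson le_trans)
  show "card (closed_nbhd z \<inter> C) \<le> 3"
  proof (cases "z \<in> C")
    case True
    then show ?thesis
      using card_induced_cycle_neighbours[OF cycle] induced_cycle_finite[OF cycle]
      unfolding closed_nbhd_inter_cycle[OF cycle True] by (simp add: card_insert_if)
  qed (use outside in force)
qed

lemma long_cycle_neighbours:
  assumes cycle: "induced_cycle C" "5 \<le> card C" and r_in: "r \<in> C"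
  obtains a b where "{w\<in>C. E r w} = {a, b}" "a \<noteq> b" "\<not> E a b" "{w\<in>C. E a w \<and> E b w} = {r}"
proof -
  obtain c where enum: "cycle_enum c (card C)" "range c = C" "c 0 = r"
    using induced_cycle_enum_from[OF cycle(1) r_in] .
  have eq: "c i = c j \<longleftrightarrow> int (card C) dvd i - j" for i j
    using enum(1) unfolding cycle_enum_def by (simp add: cong_iff_dvd_diff)
  have small: "\<not> int (card C) dvd m" if "m \<in> {1, 2, 3, 4}" for m :: int
    using cycle(2) that zdvd_not_zless[of m "int (card C)"] by auto
  note nbrs = cycle_enum_neighbours[OF enum(1), unfolded enum(2)]
  show ?thesis
  proof (rule that[of "c (- 1)" "c 1"])
    show "{w\<in>C. E r w} = {c (- 1), c 1}" "c (- 1) \<noteq> c 1"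
      using nbrs[of 0] enum(3) by simp_all
    have "c 1 \<noteq> c (- 2)" "c 1 \<noteq> c 0" using eq small[of 3] small[of 1] by auto
    then show "\<not> E (c (- 1)) (c 1)" using nbrs(1)[of "- 1"] enum(2) by auto
    have "{w\<in>C. E (c (- 1)) w \<and> E (c 1) w} = {c (- 2), c 0} \<inter> {c 0, c 2}"
      using nbrs(1)[of "- 1"] nbrs(1)[of 1] by auto
    moreover have "c (- 2) \<noteq> c 2" using eq[of 2 "- 2"] small[of 4] by auto
    ultimately show "{w\<in>C. E (c (- 1)) w \<and> E (c 1) w} = {r}" using enum(3) by auto
  qed
qed

lemma long_cycle_neighbours_not_dominated:
  assumes cycle: "induced_cycle C" "5 \<le> card C" and r_in: "r \<in> C"
  obtains a b where "{w\<in>C. E r w} = {a, b}" "a \<noteq> b" "\<not> E a b"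
    "\<forall>z. z \<noteq> r \<longrightarrow> \<not> (cmove E z a \<and> cmove E z b)"
proof -
  obtain a b where ab: "{w\<in>C. E r w} = {a, b}" "a \<noteq> b" "\<not> E a b"
    and common: "{w\<in>C. E a w \<and> E b w} = {r}"
    using long_cycle_neighbours[OF cycle r_in] .
  have abC: "a \<in> C" "b \<in> C" using ab(1) by blast+
  have "z = r" if z: "cmove E z a" "cmove E z b" for z
  proof (cases "z \<in> C")
    case True
    then show ?thesis using z common ab(2,3) adj_sym unfolding cmove_def by blast
  next
    case False
    then have "a \<in> attachments C z" "b \<in> attachments C z"
      using closed_nbhd_inter_subset_attachments[OF False] z abC unfolding closed_nbhd_def by blast+
    then show ?thesis using attachments_adjacent[OF cycle(1) False] ab(2,3) by blast
  qed
  then show ?thesis using that[OF ab] by blast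
qed

lemma long_induced_cycle_refuge:
  assumes cycle: "induced_cycle C" "5 \<le> card C"
  shows "refuge E C"
  unfolding refuge_def
proof (intro ballI allI impI)
  fix r c c' assume r_in: "r \<in> C" and cops: "c \<noteq> r" "c' \<noteq> r" "E c r" "cmove E c' c"
  obtain a b where ab: "{w\<in>C. E r w} = {a, b}" "a \<noteq> b" "\<not> E a b"
    and not_both: "\<forall>z. z \<noteq> r \<longrightarrow> \<not> (cmove E z a \<and> cmove E z b)"
    using long_cycle_neighbours_not_dominated[OF cycle r_in] .
  have abC: "a \<in> C" "b \<in> C" "E r a" "E r b" using ab(1) by blast+
  show "\<exists>b\<in>C. E r b \<and> \<not> cmove E c b \<and> \<not> cmove E c' b"
  proof (rule ccontr)
    assume "\<not> ?thesis"
    then have dom: "cmove E c a \<or> cmove E c' a" "cmove E c b \<or> cmove E c' b" using abC by blast+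
    have c_notin: "c \<notin> C"
    proof
      assume "c \<in> C"
      then have "c = a \<or> c = b" using ab(1) adj_sym[OF cops(3)] by blast
      then show False using dom not_both cops cmove_refl by metis
    qed
    have att: "w \<in> attachments C c" if "w \<in> C" "cmove E c w" for w
      using closed_nbhd_inter_subset_attachments[OF c_notin] that unfolding closed_nbhd_def by blast
    have "a \<in> attachments C c \<and> b \<in> attachments C c"
    proof (cases "c' \<in> C")
      case True
      then have "c' \<in> attachments C c" "r \<in> attachments C c"
        using att cops(3) r_in cmove_sym[OF symp_adj cops(4)] cmove_adj by metis+
      then have "E r c'" using attachments_adjacent[OF cycle(1) c_notin] cops(2) by metis
      then have "c' = a \<or> c' = b" using ab(1) True by blast
      then show ?thesis
        using \<open>c' \<in> attachments C c\<close> att abC(1,2) dom not_both cops(2) cmove_refl by metis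
    next
      case False
      have "c' \<in> component C c"
        using component_step[OF c_notin component_refl, of c'] cmove_sym[OF symp_adj cops(4)] False
          attachments_subset[of C c] component_refl[of c C] unfolding cmove_def by blast
      then show ?thesis
        using dom abC c_notin False component_refl[of c C] unfolding attachments_def cmove_def by blast
    qed
    then show False using attachments_adjacent[OF cycle(1) c_notin] ab(2,3) by blast
  qed
qed

lemma closed_nbhd_across_cycle:
  assumes k_notin: "k \<notin> C" and sub: "C' \<subseteq> component C k \<union> attachments C k"
    and z_notin: "z \<notin> C" and w_in: "w \<in> closed_nbhd z" "w \<in> C'" "w \<notin> C"
  shows "closed_nbhd z \<inter> C \<subseteq> attachments C k"
proof -
  have "w \<in> component C k" using sub w_in(2,3) attachments_subset by blast
  then have "z \<in> component C k"
    using component_step[OF k_notin, of w z] w_in(1) z_notin attachments_subset adj_sym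
    unfolding closed_nbhd_def cmove_def by blast
  then show ?thesis using z_notin unfolding closed_nbhd_def cmove_def attachments_def by blast
qed

lemma adjacent_pair_not_dominating:
  assumes cycle: "induced_cycle C" "5 \<le> card C" and xy: "x \<in> C" "y \<in> C" "x = y \<or> E x y"
  shows "\<not> C \<subseteq> closed_nbhd x \<union> closed_nbhd y"
proof
  assume dom: "C \<subseteq> closed_nbhd x \<union> closed_nbhd y"
  have "card C \<le> 4"
  proof (cases "x = y")
    case True
    then have "closed_nbhd x \<inter> C = C" using dom by blast
    then show ?thesis using card_closed_nbhd_inter_cycle(2)[OF cycle(1), of x] by simp
  next
    case False
    then have "E x y" using xy(3) by blast
    obtain p where p: "{w\<in>C. E x w} = {y, p}"
      using induced_cycle_other_neighbour[OF cycle(1) xy(1,2) \<open>E x y\<close>] .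
    obtain q where q: "{w\<in>C. E y w} = {x, q}"
      using induced_cycle_other_neighbour[OF cycle(1) xy(2,1) adj_sym[OF \<open>E x y\<close>]] .
    have "C = closed_nbhd x \<inter> C \<union> closed_nbhd y \<inter> C" using dom by blast
    also have "\<dots> = {x, y, p, q}"
      unfolding closed_nbhd_inter_cycle[OF cycle(1) xy(1)] closed_nbhd_inter_cycle[OF cycle(1) xy(2)]
        p q by auto
    finally show ?thesis by (simp add: card_insert_if)
  qed
  then show False using cycle(2) by simp
qed

lemma long_cycle_not_dominated:
  assumes "induced_cycle C" "5 \<le> card C"
  obtains w where "w \<in> C" "w \<notin> closed_nbhd x"
proof -
  have "closed_nbhd x \<inter> C \<noteq> C"
    using card_closed_nbhd_inter_cycle(2)[OF assms(1), of x] assms(2) by auto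
  then show ?thesis using that by blast
qed

lemma cycle_inter_subset_attachments:
  assumes cycle: "induced_cycle C" and cycle': "induced_cycle C'" and k_in: "k \<in> C'" "k \<notin> C"
  shows "C \<inter> C' \<subseteq> attachments C k"
  using induced_cycle_in_component[OF cycle cycle' k_in] component_disjoint[OF k_in(2)] by blast

lemma second_dominator_on_cycle:
  assumes cycle: "induced_cycle C" "5 \<le> card C" and cycle': "induced_cycle C'" "5 \<le> card C'"
    and k_in: "k \<in> C'" "k \<notin> C" and x_in: "x \<in> C" "x \<in> C'"
    and dom: "C \<union> C' \<subseteq> closed_nbhd x \<union> closed_nbhd y"
  shows "y \<in> C"
proof (rule ccontr)
  assume y_notin: "y \<notin> C"
  note inter = cycle_inter_subset_attachments[OF cycle(1) cycle'(1) k_in]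
  then have "x \<in> attachments C k" using x_in by blast
  then have near: "attachments C k \<subseteq> closed_nbhd x"
    using attachments_adjacent[OF cycle(1) k_in(2), of x] unfolding closed_nbhd_def cmove_def by blast
  obtain w where w: "w \<in> C'" "w \<notin> closed_nbhd x" using long_cycle_not_dominated[OF cycle'] .
  then have "w \<in> closed_nbhd y" "w \<notin> C" using dom inter near by blast+
  then have "closed_nbhd y \<inter> C \<subseteq> closed_nbhd x"
    using closed_nbhd_across_cycle[OF k_in(2) induced_cycle_in_component[OF cycle(1) cycle'(1) k_in]
        y_notin _ w(1)] near by blast
  then have "C \<subseteq> closed_nbhd x" using dom by blast
  then show False using long_cycle_not_dominated[OF cycle, of x] by blast
qed

lemma common_vertex_not_dominating:
  assumes cycle: "induced_cycle C" "5 \<le> card C" and cycle': "induced_cycle C'" "5 \<le> card C'"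
    and k_in: "k \<in> C'" "k \<notin> C" and l_in: "l \<in> C" "l \<notin> C'" and x_in: "x \<in> C" "x \<in> C'"
  shows "\<not> C \<union> C' \<subseteq> closed_nbhd x \<union> closed_nbhd y"
proof
  assume dom: "C \<union> C' \<subseteq> closed_nbhd x \<union> closed_nbhd y"
  have "y \<in> C" by (rule second_dominator_on_cycle[OF cycle cycle' k_in x_in dom])
  moreover have "y \<in> C'"
    using second_dominator_on_cycle[OF cycle' cycle l_in x_in(2,1)] dom by (simp add: Un_commute)
  ultimately have "x \<in> attachments C k" "y \<in> attachments C k"
    using cycle_inter_subset_attachments[OF cycle(1) cycle'(1) k_in] x_in by blast+
  then have "x = y \<or> E x y" using attachments_adjacent[OF cycle(1) k_in(2)] by blast
  then show False
    using adjacent_pair_not_dominating[OF cycle x_in(1) \<open>y \<in> C\<close>] dom by blast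
qed

lemma tight_domination:
  assumes cycle: "induced_cycle C" "5 \<le> card C" and A: "finite A" "card A \<le> 2"
    and dom: "C \<subseteq> closed_nbhd x \<union> A"
  shows "closed_nbhd x \<inter> C \<inter> A = {}" "A \<noteq> {}"
proof -
  let ?N = "closed_nbhd x \<inter> C"
  have fin: "finite ?N" using induced_cycle_finite[OF cycle(1)] by simp
  have N: "card ?N \<le> 3" by (rule card_closed_nbhd_inter_cycle(2)[OF cycle(1)])
  have "card C \<le> card (?N \<union> A)" using dom fin A(1) by (intro card_mono) auto
  moreover have "card ?N + card A = card (?N \<union> A) + card (?N \<inter> A)"
    by (rule card_Un_Int[OF fin A(1)])
  ultimately have "card (?N \<inter> A) = 0" "card A \<noteq> 0" using cycle(2) N A(2) by linarith+
  then show "?N \<inter> A = {}" "A \<noteq> {}" using A(1) by auto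
qed

lemma private_vertices_not_dominating:
  assumes cycle: "induced_cycle C" "5 \<le> card C" and cycle': "induced_cycle C'" "5 \<le> card C'"
    and x_in: "x \<in> C" "x \<notin> C'" and y_in: "y \<in> C'" "y \<notin> C"
  shows "\<not> C \<union> C' \<subseteq> closed_nbhd x \<union> closed_nbhd y"
proof
  assume dom: "C \<union> C' \<subseteq> closed_nbhd x \<union> closed_nbhd y"
  let ?A = "attachments C y" and ?A' = "attachments C' x"
  have fin: "finite ?A" "finite ?A'"
    using finite_subset[OF attachments_subset] induced_cycle_finite cycle(1) cycle'(1) by blast+
  have "C \<subseteq> closed_nbhd x \<union> ?A" "C' \<subseteq> closed_nbhd y \<union> ?A'"
    using dom closed_nbhd_inter_subset_attachments[OF x_in(2)] closed_nbhd_inter_subset_attachments[OF y_in(2)]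
    by blast+
  then have disjoint: "closed_nbhd x \<inter> C \<inter> ?A = {}" "closed_nbhd y \<inter> C' \<inter> ?A' = {}" and "?A' \<noteq> {}"
    using tight_domination[OF cycle fin(1) card_attachments_le[OF cycle(1) y_in(2)]]
      tight_domination[OF cycle' fin(2) card_attachments_le[OF cycle'(1) x_in(2)]] by blast+
  then obtain s where s: "s \<in> C'" "s \<in> closed_nbhd x" using attachments_subset dom by blast
  have "s \<in> component C y"
    using induced_cycle_in_component[OF cycle(1) cycle'(1) y_in] s disjoint(1) attachments_subset by blast
  moreover from this have "E s x"
    using s(2) x_in(1) component_disjoint[OF y_in(2)] adj_sym unfolding closed_nbhd_def cmove_def by blast
  ultimately have "x \<in> ?A" using x_in(1) unfolding attachments_def by blast
  then show False using disjoint(1) x_in(1) closed_nbhd_refl by blast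
qed

lemma distinct_long_cycles_not_dominated:
  assumes cycle: "induced_cycle C" "5 \<le> card C" and cycle': "induced_cycle C'" "5 \<le> card C'" and "C \<noteq> C'"
  shows "\<not> C \<union> C' \<subseteq> closed_nbhd x \<union> closed_nbhd y"
proof
  assume dom: "C \<union> C' \<subseteq> closed_nbhd x \<union> closed_nbhd y"
  then have dom': "C \<union> C' \<subseteq> closed_nbhd y \<union> closed_nbhd x" by blast
  obtain k l where k_in: "k \<in> C'" "k \<notin> C" and l_in: "l \<in> C" "l \<notin> C'"
    using induced_cycle_subset_eq[OF cycle(1) cycle'(1)]
      induced_cycle_subset_eq[OF cycle'(1) cycle(1)] \<open>C \<noteq> C'\<close> by blast
  have on: "x \<in> X \<or> y \<in> X" if cycle: "induced_cycle X" "5 \<le> card X" "X \<subseteq> C \<union> C'" for X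
  proof (rule ccontr)
    assume "\<not> ?thesis"
    then have "card (closed_nbhd x \<inter> X) \<le> 2" "card (closed_nbhd y \<inter> X) \<le> 2"
      using card_closed_nbhd_inter_cycle(1)[OF cycle(1)] by blast+
    moreover have "X = closed_nbhd x \<inter> X \<union> closed_nbhd y \<inter> X" using dom cycle(3) by blast
    then have "card X \<le> card (closed_nbhd x \<inter> X) + card (closed_nbhd y \<inter> X)" by (metis card_Un_le)
    ultimately show False using cycle(2) by linarith
  qed
  have "x \<notin> C \<inter> C'" "y \<notin> C \<inter> C'"
    using common_vertex_not_dominating[OF cycle cycle' k_in l_in] dom dom' by blast+
  then consider "x \<in> C" "x \<notin> C'" "y \<in> C'" "y \<notin> C" | "y \<in> C" "y \<notin> C'" "x \<in> C'" "x \<notin> C"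
    using on[OF cycle] on[OF cycle'] by blast
  then show False
    using private_vertices_not_dominating[OF cycle cycle'] dom dom' by cases blast+
qed

lemma long_cycle_dominated_by_winning_pair:
  assumes win: "\<And>r. r \<in> V \<Longrightarrow> cop_win E {#x, y#} r" and cycle: "induced_cycle C" "5 \<le> card C"
  shows "C \<subseteq> closed_nbhd x \<union> closed_nbhd y"
proof
  fix r assume r_in: "r \<in> C"
  then have "\<not> robber_safe E C {#x, y#} r"
    using robber_safe_not_cop_win[OF symp_adj long_induced_cycle_refuge[OF cycle]] win
      induced_cycle_subset_vertices[OF cycle(1)] by blast
  then show "r \<in> closed_nbhd x \<union> closed_nbhd y"
    using r_in unfolding robber_safe_def closed_nbhd_def by auto
qed

lemma cops_win_imp_few_long_cycles:
  assumes "cops_win V E 2"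
  shows "induced_cycle C \<Longrightarrow> card C \<le> 6"
    and "induced_cycle C \<Longrightarrow> induced_cycle C' \<Longrightarrow> 5 \<le> card C \<Longrightarrow> 5 \<le> card C' \<Longrightarrow> C = C'"
proof -
  obtain M where M: "size M = 2" "\<And>r. r \<in> V \<Longrightarrow> cop_win E M r"
    using assms unfolding cops_win_def by blast
  then obtain x y where "M = {#x, y#}"
    by (metis One_nat_def numeral_2_eq_2 size_1_singleton_mset size_eq_Suc_imp_eq_union size_add_mset
        nat.inject)
  then have dom: "C \<subseteq> closed_nbhd x \<union> closed_nbhd y" if "induced_cycle C" "5 \<le> card C" for C
    using long_cycle_dominated_by_winning_pair[OF _ that] M(2) by blast
  show "card C \<le> 6" if cycle: "induced_cycle C"
  proof (cases "5 \<le> card C")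
    case True
    then have "C = closed_nbhd x \<inter> C \<union> closed_nbhd y \<inter> C" using dom[OF cycle] by blast
    then have "card C \<le> card (closed_nbhd x \<inter> C) + card (closed_nbhd y \<inter> C)" by (metis card_Un_le)
    also have "\<dots> \<le> 3 + 3" by (intro add_mono card_closed_nbhd_inter_cycle(2) cycle)
    finally show ?thesis by simp
  qed simp
  show "C = C'" if "induced_cycle C" "induced_cycle C'" "5 \<le> card C" "5 \<le> card C'"
    using distinct_long_cycles_not_dominated[of C C' x y] dom[of C] dom[of C'] that by blast
qed

lemma finite_induced_cycles: "finite {C. induced_cycle C}"
  by (rule finite_subset[of _ "Pow V"]) (use induced_cycle_subset_vertices finite_vertices in auto)

theorem cops_win_2_iff:
  "cops_win V E 2 \<longleftrightarrow>
    card {C. induced_cycle C \<and> card C \<in> {5, 6}} \<le> 1 \<and> \<not> (\<exists>C. induced_cycle C \<and> card C > 6)"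
  (is "_ \<longleftrightarrow> card ?long \<le> 1 \<and> \<not> ?very_long")
proof
  have "finite ?long" by (rule finite_subset[OF _ finite_induced_cycles]) blast
  then have unique: "card ?long \<le> 1 \<longleftrightarrow> (\<forall>C\<in>?long. \<forall>C'\<in>?long. C = C')"
    using card_le_Suc0_iff_eq by (simp only: One_nat_def)
  {
    assume win: "cops_win V E 2"
    have "C = C'" if "C \<in> ?long" "C' \<in> ?long" for C C'
      using cops_win_imp_few_long_cycles(2)[OF win, of C C'] that by auto
    moreover have "\<not> ?very_long"
      using cops_win_imp_few_long_cycles(1)[OF win] linorder_not_less by blast
    ultimately show "card ?long \<le> 1 \<and> \<not> ?very_long"
      unfolding unique by blast
  next
    assume cycles: "card ?long \<le> 1 \<and> \<not> ?very_long"
    show "cops_win V E 2"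
    proof (rule cops_win_few_long_cycles)
      show at_most_6: "card C \<le> 6" if "induced_cycle C" for C
        using cycles that linorder_not_less by blast
      fix C C' assume cycle: "induced_cycle C" "induced_cycle C'" "5 \<le> card C" "5 \<le> card C'"
      then have "C \<in> ?long" "C' \<in> ?long" using at_most_6[of C] at_most_6[of C'] by auto
      then show "C = C'" using cycles unfolding unique by blast
    qed
  }
qed

end

theorem theorem4:
  fixes V :: "'a set" and E :: "'a \<Rightarrow> 'a \<Rightarrow> bool"
    and \<sigma> :: "'a \<Rightarrow> 'a \<Rightarrow> 'a" and Of :: "('a \<times> 'a) set"
  assumes "graph V E"
    and "connected_graph V E"
    and "\<not> (\<exists>v\<in>V. universal_vertex V E v)"
    and "outerplanar_embedding V E \<sigma> Of"
  shows "attacking_cop_number V E = 2 \<longleftrightarrow>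
    card {F \<in> internal_faces V E \<sigma> Of. card F \<in> {5, 6}} \<le> 1
    \<and> \<not> (\<exists>F\<in>internal_faces V E \<sigma> Of. card F > 6)"
proof -
  interpret outerplane_graph V E \<sigma> Of
    by unfold_locales (use assms(1,2,4) in \<open>simp_all add: outerplanar_embedding_def\<close>)
  have "attacking_cop_number V E = 2 \<longleftrightarrow> cops_win V E 2"
    by (rule attacking_cop_number_eq_2_iff[OF assms(1) vertices_nonempty assms(3)])
  also note cops_win_2_iff
  also note card_internal_faces_eq[of "\<lambda>n. n \<in> {5, 6}", symmetric]
  also note ex_internal_face_iff[of "\<lambda>n. n > 6", symmetric]
  finally show ?thesis .
qed

end
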